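(* Assume that conditions (A1), (A2) and (A3) (stated in the context) hold, and let $\delta\in(0,\delta_* )$. There exists a positive constant $c$ such that $$\mathbb P\big[|X_n/n-a_j|>\delta\text{ for all }j\in J\big]\le\exp(-cn)$$ and $$\mathbb P\big[|X_n/n-a_j|>\delta\text{ for all }j\in J_1\big]\le\exp(-cn\sigma_{*,n}).$$ Moreover, for any $j_2\in J_2$, there exists a constant $C$ such that, if $J_1\ne J_2$, $$\mathbb P\big[|X_n/n-a_j|>\delta\text{ for all }j\in J_2\big]\le C\max_{j_1\in J_1\setminus J_2}n^{1/(2m_{j_1})-1/(2m_{j_2})},$$ and, for any $j\in J_2$, $$\mathbb P[|X_n/n-a_j|\le\delta_*]=p_j+O(\tau_{*,n})+O\Big(\max_{k\in J_1\setminus J_2}n^{1/(2m_k)-1/(2m_j)}\Big),$$ where $$\tau_{*,n}=\frac{(\log n)^{2m_*+1}}{n^{1/(2m_* )}}+n^{1/(2m_* )-1/(2m_{j_2})}\log n\;\mathbf 1[m_{j_2}\ne m_*].$$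
   Context: Setting. Let $m_*\in\mathbb N=\{1,2,\dots\}$ and, for each $n$, let $A_n,B_n:\{0,1/n,\dots,1\}\to\mathbb R$. Put $\sigma_{*,n}=n^{-1+1/(2m_* )}$, $H_n(k/n)=nA_n(k/n)+n\sigma_{*,n}B_n(k/n)$, $Z_n=\sum_{k=0}^n\exp(H_n(k/n))$, and let $X_n$ be the random variable with $\mathbb P[X_n=k]=Z_n^{-1}\exp(H_n(k/n))$, $0\le k\le n$. Let $\varepsilon_*,\delta_*,C_*>0$ be constants, let $(a_j,m_j)_{j\in J}$ be a finite collection of pairs with $a_j\in(0,1)$, $m_j\in\mathbb N$, and let $A,B:[0,1]\to\mathbb R$ with $A\in C^{2m_*+1}([0,1])$, $B\in C^2([0,1])$. Here $[x]$ denotes the integer part of $x$. (A1) $(a_j)_{j\in J}$ are all the maximizers of $A$, and $\max_{j\in J}m_j=m_*$. For all $j\in J$: $A'(a_j)=\dots=A^{(2m_j-1)}(a_j)=0$ and $\max_{|x-a_j|\le\delta_*}A^{(2m_j)}(x)<0$. The intervals $(a_j-\delta_*,a_j+\delta_* )$, $j\in J$, are disjoint and contained in $(0,1)$. (A2) For $n$ large enough and all $k$ with $|k/n-a_j|\ge\delta_*$ for all $j\in J$: $A_n(k/n)\le\max_{x\in[0,1]}A(x)-\varepsilon_*$ and $|B_n(k/n)|\le C_*$. (A3) For $n$ large enough and all $k,\ell$ for which there is $j\in J$ with $|k/n-a_j|,|\ell/n-a_j|<\delta_*$: $|A_n(k/n)-A(k/n)|\le C_*\frac{\log n}{n}$,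 $|B_n(k/n)-B(k/n)|\le\frac{C_*}{n}$, and $\big|[A_n(k/n)-A_n(\ell/n)]-[A(k/n)-A(\ell/n)]\big|\le\frac{C_*|k-\ell|}{n^2}$. Let $J_1=\{j\in J:B(a_j)=\max_{k\in J}B(a_k)\}$ and $J_2=\{j\in J_1:m_j=\max_{k\in J_1}m_k\}$. For $j\in J_2$, $$p_j=\frac{q_je^{\nu_j}}{\sum_{k\in J_2}q_ke^{\nu_k}},\quad q_j=\int_{\mathbb R}\exp(c_jx^{2m_j}+b_jx)\,dx,\quad c_j=\frac{A^{(2m_j)}(a_j)}{(2m_j)!},\quad b_j=B'(a_j)\mathbf 1[m_j=m_*].$$ The real numbers $(\nu_j)_{j\in J_2}$ appearing in $p_j$ are those of a further condition (A4) of the setting, which reads: there exist real numbers $(\nu_j)_{j\in J_2}$ such that for $n$ large enough, with $k_j=[na_j]$, $\sup_{i,j\in J_2}\big|n[A_n(k_i/n)-A_n(k_j/n)]-(\nu_i-\nu_j)\big|\le\frac{C_*}{n\sigma_{*,n}}$. The constants in $O(\cdot)$ do not depend on $n$; $\mathbf 1[\cdot]$ is the indicator. In $\tau_{*,n}$, $j_2$ is an element of $J_2$ (the value $m_{j_2}$ is the same for all elements of $J_2$).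
   Formalization: The two exponential bounds are stated for all sufficiently large n, since for every n they fail (at n = 1 with a single maximizer at 1/2 and small δ the probability is 1); the exponents 1/(2m_{j_1}) − 1/(2m_{j_2}) are kept as printed. *)

theory Defs
  imports "HOL-Probability.Probability" "HOL-Library.Landau_Symbols"
begin

(* Derivatives are taken relative to S, i.e. one-sided at the end points of an interval.
   A function on [0,1] is a total function whose values outside [0,1] play no role. *)
primrec nth_deriv_on :: "real set \<Rightarrow> nat \<Rightarrow> (real \<Rightarrow> real) \<Rightarrow> real \<Rightarrow> real" where
  "nth_deriv_on S 0 f = f"
| "nth_deriv_on S (Suc i) f = (\<lambda>x. vector_derivative (nth_deriv_on S i f) (at x within S))"

definition C_k_on :: "nat \<Rightarrow> (real \<Rightarrow> real) \<Rightarrow> real set \<Rightarrow> bool" where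
  "C_k_on k f S \<longleftrightarrow>
     (\<forall>i<k. nth_deriv_on S i f differentiable_on S) \<and> continuous_on S (nth_deriv_on S k f)"

definition sigma_star :: "nat \<Rightarrow> nat \<Rightarrow> real" where
  "sigma_star mstar n = real n powr (-1 + 1 / (2 * real mstar))"

(* The functions An n, Bn n are only ever evaluated at the grid points k/n, k \<le> n. *)
definition H_fun ::
    "nat \<Rightarrow> (nat \<Rightarrow> real \<Rightarrow> real) \<Rightarrow> (nat \<Rightarrow> real \<Rightarrow> real) \<Rightarrow> nat \<Rightarrow> nat \<Rightarrow> real" where
  "H_fun mstar An Bn n k =
     real n * An n (real k / real n) + real n * sigma_star mstar n * Bn n (real k / real n)"

definition Z_fun ::
    "nat \<Rightarrow> (nat \<Rightarrow> real \<Rightarrow> real) \<Rightarrow> (nat \<Rightarrow> real \<Rightarrow> real) \<Rightarrow> nat \<Rightarrow> real" where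
  "Z_fun mstar An Bn n = (\<Sum>k=0..n. exp (H_fun mstar An Bn n k))"

definition cond_A1 ::
    "(real \<Rightarrow> real) \<Rightarrow> 'j set \<Rightarrow> ('j \<Rightarrow> real) \<Rightarrow> ('j \<Rightarrow> nat) \<Rightarrow> nat \<Rightarrow> real \<Rightarrow> bool" where
  "cond_A1 A J a m mstar \<delta>star \<longleftrightarrow>
     {x. is_arg_max A (\<lambda>x. x \<in> {0..1}) x} = a ` J \<and>
     Max (m ` J) = mstar \<and>
     (\<forall>j\<in>J. (\<forall>i\<in>{1..2 * m j - 1}. nth_deriv_on {0..1} i A (a j) = 0) \<and>
            (SUP x\<in>{a j - \<delta>star..a j + \<delta>star}. nth_deriv_on {0..1} (2 * m j) A x) < 0) \<and>
     disjoint_family_on (\<lambda>j. {a j - \<delta>star<..<a j + \<delta>star}) J \<and>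
     (\<forall>j\<in>J. {a j - \<delta>star<..<a j + \<delta>star} \<subseteq> {0<..<1})"

definition cond_A2 ::
    "(nat \<Rightarrow> real \<Rightarrow> real) \<Rightarrow> (nat \<Rightarrow> real \<Rightarrow> real) \<Rightarrow> (real \<Rightarrow> real) \<Rightarrow>
     'j set \<Rightarrow> ('j \<Rightarrow> real) \<Rightarrow> real \<Rightarrow> real \<Rightarrow> real \<Rightarrow> bool" where
  "cond_A2 An Bn A J a \<epsilon>star \<delta>star Cstar \<longleftrightarrow>
     (\<forall>\<^sub>F n in sequentially. \<forall>k\<le>n.
        (\<forall>j\<in>J. \<bar>real k / real n - a j\<bar> \<ge> \<delta>star) \<longrightarrow>
        An n (real k / real n) \<le> (SUP x\<in>{0..1}. A x) - \<epsilon>star \<and>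
        \<bar>Bn n (real k / real n)\<bar> \<le> Cstar)"

definition cond_A3 ::
    "(nat \<Rightarrow> real \<Rightarrow> real) \<Rightarrow> (nat \<Rightarrow> real \<Rightarrow> real) \<Rightarrow> (real \<Rightarrow> real) \<Rightarrow> (real \<Rightarrow> real) \<Rightarrow>
     'j set \<Rightarrow> ('j \<Rightarrow> real) \<Rightarrow> real \<Rightarrow> real \<Rightarrow> bool" where
  "cond_A3 An Bn A B J a \<delta>star Cstar \<longleftrightarrow>
     (\<forall>\<^sub>F n in sequentially. \<forall>k\<le>n. \<forall>l\<le>n.
        (\<exists>j\<in>J. \<bar>real k / real n - a j\<bar> < \<delta>star \<and> \<bar>real l / real n - a j\<bar> < \<delta>star) \<longrightarrow>
        \<bar>An n (real k / real n) - A (real k / real n)\<bar> \<le> Cstar * (ln (real n) / real n) \<and>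
        \<bar>Bn n (real k / real n) - B (real k / real n)\<bar> \<le> Cstar / real n \<and>
        \<bar>(An n (real k / real n) - An n (real l / real n))
           - (A (real k / real n) - A (real l / real n))\<bar>
          \<le> Cstar * \<bar>real k - real l\<bar> / (real n)^2)"

definition J1 :: "(real \<Rightarrow> real) \<Rightarrow> 'j set \<Rightarrow> ('j \<Rightarrow> real) \<Rightarrow> 'j set" where
  "J1 B J a = {j\<in>J. B (a j) = Max ((\<lambda>k. B (a k)) ` J)}"

definition J2 :: "(real \<Rightarrow> real) \<Rightarrow> 'j set \<Rightarrow> ('j \<Rightarrow> real) \<Rightarrow> ('j \<Rightarrow> nat) \<Rightarrow> 'j set" where
  "J2 B J a m = {j\<in>J1 B J a. m j = Max (m ` J1 B J a)}"

definition grid_index :: "('j \<Rightarrow> real) \<Rightarrow> nat \<Rightarrow> 'j \<Rightarrow> nat" where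
  "grid_index a n j = nat \<lfloor>real n * a j\<rfloor>"

definition cond_A4 ::
    "(nat \<Rightarrow> real \<Rightarrow> real) \<Rightarrow> (real \<Rightarrow> real) \<Rightarrow>
     'j set \<Rightarrow> ('j \<Rightarrow> real) \<Rightarrow> ('j \<Rightarrow> nat) \<Rightarrow> nat \<Rightarrow> real \<Rightarrow> ('j \<Rightarrow> real) \<Rightarrow> bool" where
  "cond_A4 An B J a m mstar Cstar \<nu> \<longleftrightarrow>
     (\<forall>\<^sub>F n in sequentially. \<forall>i\<in>J2 B J a m. \<forall>j\<in>J2 B J a m.
        \<bar>real n * (An n (real (grid_index a n i) / real n)
                   - An n (real (grid_index a n j) / real n)) - (\<nu> i - \<nu> j)\<bar>
          \<le> Cstar / (real n * sigma_star mstar n))"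

definition c_coef :: "(real \<Rightarrow> real) \<Rightarrow> ('j \<Rightarrow> real) \<Rightarrow> ('j \<Rightarrow> nat) \<Rightarrow> 'j \<Rightarrow> real" where
  "c_coef A a m j = nth_deriv_on {0..1} (2 * m j) A (a j) / fact (2 * m j)"

definition b_coef :: "(real \<Rightarrow> real) \<Rightarrow> ('j \<Rightarrow> real) \<Rightarrow> ('j \<Rightarrow> nat) \<Rightarrow> nat \<Rightarrow> 'j \<Rightarrow> real" where
  "b_coef B a m mstar j = nth_deriv_on {0..1} 1 B (a j) * of_bool (m j = mstar)"

definition q_weight ::
    "(real \<Rightarrow> real) \<Rightarrow> (real \<Rightarrow> real) \<Rightarrow> ('j \<Rightarrow> real) \<Rightarrow> ('j \<Rightarrow> nat) \<Rightarrow> nat \<Rightarrow> 'j \<Rightarrow> real" where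
  "q_weight A B a m mstar j =
     (\<integral>x. exp (c_coef A a m j * x ^ (2 * m j) + b_coef B a m mstar j * x) \<partial>lborel)"

definition p_weight ::
    "(real \<Rightarrow> real) \<Rightarrow> (real \<Rightarrow> real) \<Rightarrow> 'j set \<Rightarrow> ('j \<Rightarrow> real) \<Rightarrow> ('j \<Rightarrow> nat) \<Rightarrow> nat \<Rightarrow>
     ('j \<Rightarrow> real) \<Rightarrow> 'j \<Rightarrow> real" where
  "p_weight A B J a m mstar \<nu> j =
     q_weight A B a m mstar j * exp (\<nu> j) /
     (\<Sum>k\<in>J2 B J a m. q_weight A B a m mstar k * exp (\<nu> k))"

definition tau_star :: "nat \<Rightarrow> nat \<Rightarrow> nat \<Rightarrow> real" where
  "tau_star mstar m2 n =
     (ln (real n)) ^ (2 * mstar + 1) / real n powr (1 / (2 * real mstar)) +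
     real n powr (1 / (2 * real mstar) - 1 / (2 * real m2)) * ln (real n) * of_bool (m2 \<noteq> mstar)"

(* The maximum over k \<in> K of n^(1/(2 m_k) - 1/(2 m2)); a maximum over the empty set is
   read as an absent term, i.e. as 0. *)
definition max_power :: "('j \<Rightarrow> nat) \<Rightarrow> 'j set \<Rightarrow> nat \<Rightarrow> nat \<Rightarrow> real" where
  "max_power m K m2 n =
     (if K = {} then 0
      else Max ((\<lambda>k. real n powr (1 / (2 * real (m k)) - 1 / (2 * real m2))) ` K))"

end

(* Write s = n^(1/(2 m_j)) and y = (k/n - a_j) s. Near a_j, Taylor expansion turns
   H_n(k/n) into a constant plus c_j y^(2 m_j) + b_j y, up to an error polynomial in |y|
   times a vanishing factor, and bounds it above by a constant minus a multiple of y^2.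
   The weights near a_j, rescaled by the mesh s/n, therefore form a step function of y that
   differs from exp(c_j y^(2 m_j) + b_j y) by at most a vanishing factor times one fixed
   Gaussian-dominated function; integrating this pointwise bound gives q_j together with the
   error term. Condition (A4) compares the constants of different wells. Points away from the
   relevant maximizers lose c n in n A_n, or c n sigma_n in n sigma_n B_n, which beats the
   O(log n) uncertainty in n A_n.

   If J_1 differs from J_2, the exponents 1/(2 m_k) - 1/(2 m_j) are positive, so the bounds
   involving them exceed 1 and only the case J_1 = J_2 needs an argument. *)
theory Submission
  imports Defs "HOL-Real_Asymp.Real_Asymp"
begin

text \<open>The obstacle is that (A3) fixes \<open>A_n\<close> only up to \<open>log n / n\<close>,
  so \<open>n A_n\<close> is known only up to \<open>O(log n)\<close>, too coarse for limiting
  weights. Within one well, however, differences of \<open>A_n\<close> follow those of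
  \<open>A\<close> up to \<open>|k - l| / n^2\<close>. Hence the constant of a well contains
  \<open>n A_n\<close> at the grid point next to a_j instead of \<open>n A(a_j)\<close>, and (A4)
  supplies exactly the missing comparison between wells. The usual splitting of a well at a
  logarithmic multiple of its width is avoided: the quadratic upper bound holds on the whole well,
  whatever m_j is, so the polynomial factor in the error is integrable and no cut-off is needed. The
  resulting rate \<open>laplace_error\<close> contains no logarithm and is dominated by
  \<open>tau_star\<close>. Wells are summed over a radius d strictly below
  \<open>\<delta>star\<close>, where (A3) applies, while the event in the last claim has radius
  \<open>\<delta>star\<close>. The points in between are farther than d from every maximizer, so
  they belong to an event already known to be exponentially small.\<close>

section \<open>Real analysis\<close>

lemma nth_deriv_on_has_real_derivative:
  assumes "C_k_on k f S" "i < k" "x \<in> S"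
  shows "(nth_deriv_on S i f has_real_derivative nth_deriv_on S (Suc i) f x) (at x within S)"
  using assms
  by (auto simp: C_k_on_def differentiable_on_def has_real_derivative_iff_has_vector_derivative
      vector_derivative_works[symmetric])

lemma continuous_on_nth_deriv_on:
  assumes "C_k_on k f S" "i \<le> k"
  shows "continuous_on S (nth_deriv_on S i f)"
  using assms by (cases "i = k") (auto simp: C_k_on_def intro: differentiable_imp_continuous_on)

lemma nth_deriv_on_bounded:
  assumes "C_k_on k f {a..b}" "i \<le> k"
  obtains L where "L > 0" "\<And>x. x \<in> {a..b} \<Longrightarrow> \<bar>nth_deriv_on {a..b} i f x\<bar> \<le> L"
proof -
  have "bounded (nth_deriv_on {a..b} i f ` {a..b})"
    by (intro compact_imp_bounded compact_continuous_image continuous_on_nth_deriv_on[OF assms])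
       auto
  then show ?thesis
    using that by (force simp: bounded_pos)
qed

lemma C_k_on_lipschitz:
  assumes "C_k_on k f {a..b}" "k \<ge> 1"
  obtains L where "L > 0"
    "\<And>x y. x \<in> {a..b} \<Longrightarrow> y \<in> {a..b} \<Longrightarrow> \<bar>f x - f y\<bar> \<le> L * \<bar>x - y\<bar>"
proof -
  obtain L where L: "L > 0" "\<And>x. x \<in> {a..b} \<Longrightarrow> \<bar>nth_deriv_on {a..b} 1 f x\<bar> \<le> L"
    using nth_deriv_on_bounded[OF assms] by blast
  have "\<bar>f x - f y\<bar> \<le> L * \<bar>x - y\<bar>" if "x \<in> {a..b}" "y \<in> {a..b}" for x y
  proof -
    have "(f has_field_derivative nth_deriv_on {a..b} 1 f z) (at z within {a..b})"
      if "z \<in> {a..b}" for z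
      using nth_deriv_on_has_real_derivative[OF assms(1), of 0 z] assms(2) that by simp
    then show ?thesis
      using field_differentiable_bound[of "{a..b}" f "nth_deriv_on {a..b} 1 f" L x y] L that
      by auto
  qed
  with L(1) show ?thesis
    using that by blast
qed

text \<open>The classical expansion needs two-sided derivatives, while \<open>nth_deriv_on\<close>
  differentiates relative to \<open>{u..v}\<close>. The strict inequalities \<open>u < p\<close> and
  \<open>q < v\<close> put \<open>{p..q}\<close> in the interior, where the two notions
  agree.\<close>

lemma nth_deriv_on_taylor:
  assumes "C_k_on k f {u..v}" "0 < i" "i \<le> k" "u < p" "q < v" "c \<in> {p..q}" "x \<in> {p..q}"
  obtains \<xi> where "\<xi> \<in> {p..q}"
    "f x = (\<Sum>l<i. nth_deriv_on {u..v} l f c / fact l * (x - c) ^ l)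
             + nth_deriv_on {u..v} i f \<xi> / fact i * (x - c) ^ i"
proof (cases "x = c")
  case True
  have "(\<Sum>l<i. nth_deriv_on {u..v} l f c / fact l * (x - c) ^ l) = f c"
    using \<open>0 < i\<close> True by (subst sum.remove[of _ 0]) (auto intro!: sum.neutral simp: Suc_le_eq)
  then show ?thesis
    using that[of c] assms True by (simp add: zero_power)
next
  case False
  have "DERIV (nth_deriv_on {u..v} l f) t :> nth_deriv_on {u..v} (Suc l) f t"
    if "l < i" "p \<le> t" "t \<le> q" for l t
    using nth_deriv_on_has_real_derivative[OF assms(1), of l t] that assms
    by (simp add: at_within_Icc_at)
  then have "\<exists>t. (if x < c then x < t \<and> t < c else c < t \<and> t < x) \<and>
     f x = (\<Sum>l<i. nth_deriv_on {u..v} l f c / fact l * (x - c) ^ l)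
             + nth_deriv_on {u..v} i f t / fact i * (x - c) ^ i"
    using assms False
    by (intro Taylor[where a = p and b = q]) auto
  then obtain t where "if x < c then x < t \<and> t < c else c < t \<and> t < x" and
    eq: "f x = (\<Sum>l<i. nth_deriv_on {u..v} l f c / fact l * (x - c) ^ l)
             + nth_deriv_on {u..v} i f t / fact i * (x - c) ^ i" by blast
  then have "t \<in> {p..q}"
    using assms by (auto split: if_splits)
  with eq show ?thesis
    using that by blast
qed

lemma taylor_sum_flat:
  fixes D :: "nat \<Rightarrow> real"
  assumes "0 < i" "\<forall>l\<in>{1..i-1}. D l = 0"
  shows "(\<Sum>l<i. D l / fact l * z ^ l) = D 0"
proof -
  have "D l = 0" if "l < i" "l \<noteq> 0" for l
    using assms(2) that by auto
  then have "(\<Sum>l<i. D l / fact l * z ^ l) = (\<Sum>l<i. if l = 0 then D 0 else 0)"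
    by (intro sum.cong) auto
  also have "\<dots> = D 0"
    using assms(1) by (simp add: sum.delta)
  finally show ?thesis .
qed

text \<open>With the derivatives of order 1 to i - 1 zero, the remainder alone carries the size and
  the sign of \<open>f x - f c\<close>.\<close>

lemma taylor_remainder_flat:
  assumes "C_k_on k f {u..v}" "0 < i" "i \<le> k" "u < p" "q < v" "c \<in> {p..q}" "x \<in> {p..q}"
    and "\<forall>l\<in>{1..i-1}. nth_deriv_on {u..v} l f c = 0"
  obtains \<xi> where "\<xi> \<in> {p..q}"
    "f x = f c + nth_deriv_on {u..v} i f \<xi> / fact i * (x - c) ^ i"
proof -
  have "(\<Sum>l<i. nth_deriv_on {u..v} l f c / fact l * (x - c) ^ l) = f c"
    using taylor_sum_flat[of i "\<lambda>l. nth_deriv_on {u..v} l f c"] assms(2,8) by simp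
  then show ?thesis
    using nth_deriv_on_taylor[OF assms(1-7)] that by metis
qed

text \<open>One order further, the i-th derivative is frozen at c, which isolates the leading
  coefficient and leaves an error of the next power.\<close>

lemma taylor_remainder_flat_Suc:
  assumes "C_k_on k f {u..v}" "0 < i" "Suc i \<le> k" "u < p" "q < v" "c \<in> {p..q}" "x \<in> {p..q}"
    and "\<forall>l\<in>{1..i-1}. nth_deriv_on {u..v} l f c = 0"
  obtains \<xi> where "\<xi> \<in> {p..q}"
    "f x = f c + nth_deriv_on {u..v} i f c / fact i * (x - c) ^ i
       + nth_deriv_on {u..v} (Suc i) f \<xi> / fact (Suc i) * (x - c) ^ Suc i"
proof -
  have "(\<Sum>l<Suc i. nth_deriv_on {u..v} l f c / fact l * (x - c) ^ l)
      = f c + nth_deriv_on {u..v} i f c / fact i * (x - c) ^ i"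
    using taylor_sum_flat[of i "\<lambda>l. nth_deriv_on {u..v} l f c"] assms(2,8) by simp
  then show ?thesis
    using nth_deriv_on_taylor[OF assms(1) _ assms(3-7)] that by (metis zero_less_Suc)
qed

section \<open>Elementary inequalities for powers and exponentials\<close>

lemma power_diff_abs_le:
  fixes x y :: real
  shows "\<bar>x ^ n - y ^ n\<bar> \<le> real n * \<bar>x - y\<bar> * (max \<bar>x\<bar> \<bar>y\<bar>) ^ (n - 1)"
proof (induction n)
  case (Suc n)
  let ?M = "max \<bar>x\<bar> \<bar>y\<bar>"
  have "x ^ Suc n - y ^ Suc n = x * (x ^ n - y ^ n) + (x - y) * y ^ n"
    by (simp add: algebra_simps)
  then have "\<bar>x ^ Suc n - y ^ Suc n\<bar> \<le> \<bar>x\<bar> * \<bar>x ^ n - y ^ n\<bar> + \<bar>x - y\<bar> * \<bar>y\<bar> ^ n"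
    by (metis abs_mult abs_triangle_ineq power_abs)
  also have "\<dots> \<le> ?M * (real n * \<bar>x - y\<bar> * ?M ^ (n - 1)) + \<bar>x - y\<bar> * ?M ^ n"
    using Suc.IH by (intro add_mono mult_mono power_mono) auto
  also have "\<dots> = real (Suc n) * \<bar>x - y\<bar> * ?M ^ n"
    by (cases n) (auto simp: algebra_simps)
  finally show ?case by simp
qed simp

text \<open>By \<open>1 + t \<le> exp t\<close>. The factor involves any common bound w of both
  exponents, so that one Gaussian can stand for a weight and its limit alike.\<close>

lemma abs_exp_diff_le:
  fixes u v w :: real
  assumes "u \<le> w" "v \<le> w"
  shows "\<bar>exp u - exp v\<bar> \<le> \<bar>u - v\<bar> * exp w"
proof -
  have le: "exp s - exp t \<le> (s - t) * exp s" if "t \<le> s" for s t :: real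
  proof -
    have "1 - (s - t) \<le> exp (t - s)"
      using exp_ge_add_one_self[of "t - s"] by linarith
    then have "(1 - (s - t)) * exp s \<le> exp (t - s) * exp s"
      by (intro mult_right_mono) auto
    then show ?thesis
      by (simp add: exp_add[symmetric] algebra_simps)
  qed
  show ?thesis
  proof (cases "v \<le> u")
    case True
    have "(u - v) * exp u \<le> (u - v) * exp w"
      using True assms by (intro mult_left_mono) auto
    with le[OF True] True show ?thesis by simp
  next
    case False
    then have "(v - u) * exp v \<le> (v - u) * exp w"
      using assms by (intro mult_left_mono) auto
    moreover have "\<bar>u - v\<bar> * exp w = (v - u) * exp w" "exp u \<le> exp v" "u \<le> v"
      using False by auto
    ultimately show ?thesis
      using le[of u v] by linarith
  qed
qed

text \<open>Uses \<open>y^2 - 1 \<le> y^(2m)\<close> and completes a square in \<open>L |y|\<close>,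
  spending half of the quadratic term. It turns a tilted well of any even degree into a Gaussian
  bound.\<close>

lemma even_power_quadratic_bound:
  fixes c L y :: real
  assumes "c > 0" "m \<ge> 1"
  shows "- c * y ^ (2 * m) + L * \<bar>y\<bar> \<le> c + L\<^sup>2 / (2 * c) - c / 2 * y\<^sup>2"
proof -
  have "y\<^sup>2 - 1 \<le> y ^ (2 * m)"
  proof (cases "\<bar>y\<bar> \<ge> 1")
    case True
    then have "y\<^sup>2 \<le> (y\<^sup>2) ^ m"
      using assms abs_le_square_iff[of 1 y] by (intro self_le_power) auto
    then show ?thesis by (simp add: power_mult)
  next
    case False
    then have "y\<^sup>2 \<le> 1" by (simp add: abs_square_le_1)
    moreover have "0 \<le> y ^ (2 * m)"
      by (simp add: power_mult)
    ultimately show ?thesis by linarith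
  qed
  then have "- c * y ^ (2 * m) \<le> c - c * y\<^sup>2"
    using mult_left_mono[of "y\<^sup>2 - 1" "y ^ (2 * m)" c] assms by (simp add: algebra_simps)
  moreover have "L * \<bar>y\<bar> \<le> L\<^sup>2 / (2 * c) + c / 2 * y\<^sup>2"
  proof -
    have "0 \<le> (L - c * \<bar>y\<bar>)\<^sup>2 / (2 * c)"
      using assms by simp
    also have "\<dots> = L\<^sup>2 / (2 * c) + c / 2 * y\<^sup>2 - L * \<bar>y\<bar>"
      using assms by (simp add: field_simps power2_eq_square)
    finally show ?thesis by simp
  qed
  ultimately show ?thesis by simp
qed

section \<open>Gaussian-dominated integrals and their Riemann sums\<close>

lemma integrable_power_exp_neg_square:
  fixes \<kappa> C :: real
  assumes "\<kappa> > 0"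
  shows "integrable lborel (\<lambda>y::real. (1 + \<bar>y\<bar>) ^ N * exp (C - \<kappa> * y\<^sup>2))"
proof -
  \<comment> \<open>With this deviation the Gaussian factor is a multiple of a centred normal
    density. Since (1 + |y|)^N \<le> 2^N (1 + |y|^N), its absolute moments of orders 0 and N
    suffice.\<close>
  define \<sigma> where "\<sigma> = 1 / sqrt (2 * \<kappa>)"
  have \<sigma>: "\<sigma> > 0" "1 / (2 * \<sigma>\<^sup>2) = \<kappa>"
    using assms by (auto simp: \<sigma>_def power_divide)
  define K where "K = sqrt (2 * pi * \<sigma>\<^sup>2) * exp C * 2 ^ N"
  have "integrable lborel (\<lambda>y. K * (normal_density 0 \<sigma> y * \<bar>y - 0\<bar> ^ 0)
          + K * (normal_density 0 \<sigma> y * \<bar>y - 0\<bar> ^ N))"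
    by (intro Bochner_Integration.integrable_add integrable_mult_right
        integrable_normal_moment_abs \<sigma>(1))
  then show ?thesis
  proof (rule Bochner_Integration.integrable_bound, goal_cases)
    case 1
    show ?case by measurable
  next
    case 2
    have "(1 + \<bar>y\<bar>) ^ N * exp (C - \<kappa> * y\<^sup>2) \<le> K * (normal_density 0 \<sigma> y * \<bar>y - 0\<bar> ^ 0)
          + K * (normal_density 0 \<sigma> y * \<bar>y - 0\<bar> ^ N)" for y
    proof -
      have "- (y\<^sup>2 / (2 * \<sigma>\<^sup>2)) = - \<kappa> * y\<^sup>2"
        by (simp add: \<sigma>(2)[symmetric])
      then have ex: "exp (C - \<kappa> * y\<^sup>2) = exp C * (sqrt (2 * pi * \<sigma>\<^sup>2) * normal_density 0 \<sigma> y)"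
        using \<sigma>(1) by (simp add: normal_density_def exp_add[symmetric])
      have "(1 + \<bar>y\<bar>) ^ N \<le> (2 * max 1 \<bar>y\<bar>) ^ N"
        by (intro power_mono) auto
      also have "\<dots> \<le> 2 ^ N * (1 + \<bar>y\<bar> ^ N)"
        by (auto simp: power_mult_distrib max_def)
      finally have "(1 + \<bar>y\<bar>) ^ N * exp (C - \<kappa> * y\<^sup>2) \<le> 2 ^ N * (1 + \<bar>y\<bar> ^ N) * exp (C - \<kappa> * y\<^sup>2)"
        by (intro mult_right_mono) auto
      then show ?thesis
        unfolding ex by (simp add: K_def algebra_simps)
    qed
    then show ?case
      by (intro AE_I2) (simp add: order_trans[OF _ abs_ge_self])
  qed
qed

lemma integrable_exp_le_gaussian:
  fixes v :: "real \<Rightarrow> real"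
  assumes "\<kappa> > 0" "continuous_on UNIV v" "\<And>y. v y \<le> C - \<kappa> * y\<^sup>2"
  shows "integrable lborel (\<lambda>y. exp (v y))"
proof (rule Bochner_Integration.integrable_bound)
  show "integrable lborel (\<lambda>y. (1 + \<bar>y\<bar>) ^ 0 * exp (C - \<kappa> * y\<^sup>2))"
    using assms(1) by (rule integrable_power_exp_neg_square)
  show "(\<lambda>y. exp (v y)) \<in> borel_measurable lborel"
    using assms(2) by (simp add: borel_measurable_continuous_onI continuous_on_exp)
  show "AE y in lborel. norm (exp (v y)) \<le> norm ((1 + \<bar>y\<bar>) ^ 0 * exp (C - \<kappa> * y\<^sup>2))"
    using assms(3) by simp
qed

text \<open>The exponential never vanishes, so integral 0 would make the whole line a null
  set.\<close>

lemma integral_exp_pos: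
  fixes v :: "real \<Rightarrow> real"
  assumes "integrable lborel (\<lambda>y. exp (v y))"
  shows "(\<integral>y. exp (v y) \<partial>lborel) > 0"
proof -
  have "(\<integral>y. exp (v y) \<partial>lborel) \<noteq> 0"
  proof
    assume "(\<integral>y. exp (v y) \<partial>lborel) = 0"
    then have "AE y in lborel. exp (v y) = 0"
      using integral_nonneg_eq_0_iff_AE[OF assms] by simp
    then have "AE y in (lborel :: real measure). False" by simp
    then show False by (simp add: AE_iff_measurable[OF _ refl])
  qed
  moreover have "(\<integral>y. exp (v y) \<partial>lborel) \<ge> 0" by simp
  ultimately show ?thesis by linarith
qed

text \<open>Here \<open>h\<close> is the mesh, \<open>t\<close> the real-valued index of the centre,
  \<open>D\<close> the radius of the window and \<open>\<epsilon>\<close> the error rate.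
  \<open>D \<le> h * t\<close> keeps the window over nonnegative indices, and
  \<open>1 / D \<le> E * \<epsilon>\<close> makes the region outside the window cost a multiple of
  \<open>\<epsilon>\<close> too. The sum is the integral of a step function, which is compared with
  \<open>exp (v y)\<close> pointwise.\<close>

lemma riemann_sum_integral_bound:
  fixes v :: "real \<Rightarrow> real" and u :: "nat \<Rightarrow> real" and h t D \<epsilon> E C L \<kappa> :: real
  defines "K \<equiv> {k. \<bar>h * (real k - t)\<bar> \<le> D}"
  assumes "0 < h" "h \<le> 1" "h \<le> \<epsilon>" "2 \<le> D" "D \<le> h * t" "1 / D \<le> E * \<epsilon>"
    and "0 < \<kappa>" "0 \<le> L" "0 \<le> E" "N \<ge> 1"
    and v_cont: "continuous_on UNIV v"
    and v_le: "\<And>y. v y \<le> C - \<kappa> * y\<^sup>2"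
    and v_lip: "\<And>p q. \<bar>p - q\<bar> \<le> 1 \<Longrightarrow> \<bar>v p - v q\<bar> \<le> L * \<bar>p - q\<bar> * (1 + \<bar>q\<bar>) ^ N"
    and u_near: "\<And>k. k \<in> K \<Longrightarrow>
      \<bar>u k - v (h * (real k - t))\<bar> \<le> E * \<epsilon> * (1 + \<bar>h * (real k - t)\<bar>) ^ N"
    and u_le: "\<And>k. k \<in> K \<Longrightarrow> u k \<le> C - \<kappa> * (h * (real k - t))\<^sup>2"
  shows "\<bar>h * (\<Sum>k\<in>K. exp (u k)) - (\<integral>y. exp (v y) \<partial>lborel)\<bar>
    \<le> \<epsilon> * ((2 ^ N * E + L + 2 * E) *
          (\<integral>y. (1 + \<bar>y\<bar>) ^ N * exp (C + \<kappa> - \<kappa> / 2 * y\<^sup>2) \<partial>lborel))"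
proof -
  \<comment> \<open>\<open>G\<close> dominates all errors. Passing from the left end z of a cell to
    a point y of it halves \<open>\<kappa>\<close> and adds \<open>\<kappa>\<close> to the constant,
    because y^2 \<le> 2 z^2 + 2.\<close>
  define G where "G y = (1 + \<bar>y\<bar>) ^ N * exp (C + \<kappa> - \<kappa> / 2 * y\<^sup>2)" for y :: real
  define I where "I k = {h * (real k - t)..<h * (real k + 1 - t)}" for k :: nat
  define S where "S y = (\<Sum>k\<in>K. exp (u k) * indicator (I k) y)" for y
  \<comment> \<open>The summands pay for the mismatch of u and v at the grid point (2^N turns 1 +
    |z| into 1 + |y|), for the variation of v across a cell, and for the region outside the
    window.\<close>
  define Q where "Q = 2 ^ N * E + L + 2 * E"
  have "\<epsilon> > 0" using assms by linarith
  have "Q \<ge> 0" using assms by (simp add: Q_def)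
  have G_int: "integrable lborel G"
    unfolding G_def using \<open>\<kappa> > 0\<close> by (intro integrable_power_exp_neg_square) simp
  have "finite K"
  proof (rule finite_subset)
    show "K \<subseteq> {..nat \<lceil>t + D / h\<rceil>}"
    proof
      fix k assume "k \<in> K"
      then have "h * (real k - t) \<le> D" by (simp add: K_def abs_le_iff)
      then have "real k \<le> t + D / h"
        using \<open>0 < h\<close> by (simp add: field_simps)
      then show "k \<in> {..nat \<lceil>t + D / h\<rceil>}" by simp linarith
    qed
  qed simp
  have v_le': "exp (v y) \<le> exp (C + \<kappa> - \<kappa> / 2 * y\<^sup>2)" for y
  proof -
    have "\<kappa> * y\<^sup>2 = \<kappa> / 2 * y\<^sup>2 + \<kappa> / 2 * y\<^sup>2" "0 \<le> \<kappa> / 2 * y\<^sup>2"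
      using \<open>0 < \<kappa>\<close> by auto
    then have "v y \<le> C + \<kappa> - \<kappa> / 2 * y\<^sup>2"
      using v_le[of y] \<open>0 < \<kappa>\<close> by linarith
    then show ?thesis by simp
  qed
  have pow1: "1 \<le> (1 + \<bar>y\<bar>) ^ N" for y :: real
    by (intro one_le_power) simp
  have f_int: "integrable lborel (\<lambda>y. exp (v y))"
    using \<open>\<kappa> > 0\<close> v_cont v_le by (rule integrable_exp_le_gaussian)
  have I_meas: "measure lborel (I k) = h" for k
    using \<open>0 < h\<close> by (simp add: I_def algebra_simps)
  have I_int: "integrable lborel (indicator (I k) :: real \<Rightarrow> real)" for k
  proof (rule integrable_real_indicator)
    show "emeasure lborel (I k) < \<infinity>"
      by (intro emeasure_bounded_finite bounded_subset[OF bounded_closed_interval])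
         (auto simp: I_def intro: less_imp_le)
  qed (simp add: I_def)
  have S_int: "integrable lborel S"
    unfolding S_def by (intro Bochner_Integration.integrable_sum integrable_mult_right I_int)
  have S_integral: "(\<integral>y. S y \<partial>lborel) = h * (\<Sum>k\<in>K. exp (u k))"
    unfolding S_def
    by (subst Bochner_Integration.integral_sum)
       (auto intro!: integrable_mult_right I_int sum.cong simp: I_meas sum_distrib_left)
  \<comment> \<open>The cells are fibres of one floor function, hence disjoint, and they cover every
    y with y / h + t \<ge> 0.\<close>
  have I_iff: "y \<in> I k \<longleftrightarrow> \<lfloor>y / h + t\<rfloor> = int k" for y k
    using \<open>0 < h\<close> by (auto simp: I_def floor_eq_iff field_simps)
  have main: "\<bar>S y - exp (v y)\<bar> \<le> \<epsilon> * (Q * G y)" for y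
  proof (cases "\<exists>k\<in>K. y \<in> I k")
    case True
    then obtain k where k: "k \<in> K" "y \<in> I k" by blast
    define z where "z = h * (real k - t)"
    have "S y = (\<Sum>l\<in>K. if l = k then exp (u k) else 0)"
      unfolding S_def using k(2) by (intro sum.cong) (auto simp: I_iff)
    then have S: "S y = exp (u k)"
      using \<open>finite K\<close> k(1) by simp
    have z: "z \<le> y" "y < z + h"
      using k(2) by (auto simp: I_def z_def algebra_simps)
    then have yz: "\<bar>y - z\<bar> \<le> h" "\<bar>z - y\<bar> \<le> 1" "\<bar>z - y\<bar> \<le> \<epsilon>" using assms by auto
    have "y\<^sup>2 \<le> 2 * z\<^sup>2 + 2"
    proof -
      have "y\<^sup>2 + (2 * z - y)\<^sup>2 = 2 * z\<^sup>2 + 2 * (z - y)\<^sup>2"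
        by (simp add: power2_eq_square algebra_simps)
      moreover have "(z - y)\<^sup>2 \<le> 1"
        using yz(2) by (simp add: abs_square_le_1)
      moreover have "0 \<le> (2 * z - y)\<^sup>2" by simp
      ultimately show ?thesis by linarith
    qed
    then have "\<kappa> / 2 * y\<^sup>2 \<le> \<kappa> / 2 * (2 * z\<^sup>2 + 2)"
      using \<open>0 < \<kappa>\<close> by (intro mult_left_mono) auto
    then have "u k \<le> C + \<kappa> - \<kappa> / 2 * y\<^sup>2"
      using u_le[OF k(1), folded z_def] by (simp add: distrib_left)
    then have 1: "\<bar>exp (u k) - exp (v y)\<bar> \<le> \<bar>u k - v y\<bar> * exp (C + \<kappa> - \<kappa> / 2 * y\<^sup>2)"
      using v_le'[of y] by (intro abs_exp_diff_le) auto
    have "(1 + \<bar>z\<bar>) ^ N \<le> (2 * (1 + \<bar>y\<bar>)) ^ N"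
      using yz by (intro power_mono) auto
    also have "\<dots> = 2 ^ N * (1 + \<bar>y\<bar>) ^ N"
      by (rule power_mult_distrib)
    finally have "(1 + \<bar>z\<bar>) ^ N \<le> 2 ^ N * (1 + \<bar>y\<bar>) ^ N" .
    then have "E * \<epsilon> * (1 + \<bar>z\<bar>) ^ N \<le> E * \<epsilon> * (2 ^ N * (1 + \<bar>y\<bar>) ^ N)"
      using \<open>0 \<le> E\<close> \<open>0 < \<epsilon>\<close> by (intro mult_left_mono) auto
    moreover have "\<bar>u k - v z\<bar> \<le> E * \<epsilon> * (1 + \<bar>z\<bar>) ^ N"
      using u_near[OF k(1)] by (simp add: z_def)
    moreover have "\<bar>v z - v y\<bar> \<le> L * \<epsilon> * (1 + \<bar>y\<bar>) ^ N"
      using yz \<open>0 \<le> L\<close>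
      by (intro order_trans[OF v_lip[OF yz(2)]] mult_right_mono mult_left_mono) auto
    moreover have "\<epsilon> * (Q * (1 + \<bar>y\<bar>) ^ N) = E * \<epsilon> * (2 ^ N * (1 + \<bar>y\<bar>) ^ N)
        + L * \<epsilon> * (1 + \<bar>y\<bar>) ^ N + 2 * E * \<epsilon> * (1 + \<bar>y\<bar>) ^ N"
      by (simp add: Q_def algebra_simps)
    moreover have "0 \<le> 2 * E * \<epsilon> * (1 + \<bar>y\<bar>) ^ N"
      using \<open>0 \<le> E\<close> \<open>0 < \<epsilon>\<close> by simp
    ultimately have "\<bar>u k - v y\<bar> \<le> \<epsilon> * (Q * (1 + \<bar>y\<bar>) ^ N)"
      by linarith
    then have "\<bar>u k - v y\<bar> * exp (C + \<kappa> - \<kappa> / 2 * y\<^sup>2)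
        \<le> \<epsilon> * (Q * (1 + \<bar>y\<bar>) ^ N) * exp (C + \<kappa> - \<kappa> / 2 * y\<^sup>2)"
      by (intro mult_right_mono) auto
    from order_trans[OF 1 this] show ?thesis
      by (simp add: S G_def mult.assoc)
  next
    case False
    then have S: "S y = 0"
      by (auto simp: S_def)
    \<comment> \<open>A point with |y| < D / 2 would lie in a cell of \<open>K\<close>: its floor
      index is nonnegative as \<open>D \<le> h * t\<close>, and the left end of the cell stays
      within D because h \<le> 1 \<le> D / 2.\<close>
    have "\<bar>y\<bar> \<ge> D / 2"
    proof (rule ccontr)
      assume "\<not> \<bar>y\<bar> \<ge> D / 2"
      then have y: "\<bar>y\<bar> < D / 2" by simp
      define k where "k = nat \<lfloor>y / h + t\<rfloor>"
      have "0 \<le> y + h * t" using y assms by linarith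
      then have "0 \<le> (y + h * t) / h" using assms by simp
      also have "\<dots> = y / h + t" using assms by (simp add: field_simps)
      finally have "\<lfloor>y / h + t\<rfloor> = int k" by (simp add: k_def)
      then have "y \<in> I k" by (simp add: I_iff)
      then have "h * (real k - t) \<le> y" "y < h * (real k - t) + h"
        by (auto simp: I_def algebra_simps)
      then have "\<bar>h * (real k - t)\<bar> \<le> D" using y assms by linarith
      then have "k \<in> K" by (simp add: K_def)
      with \<open>y \<in> I k\<close> False show False by blast
    qed
    \<comment> \<open>Outside the window the factor \<open>\<epsilon>\<close> is bought with one
      power of |y|; this is where N \<ge> 1 enters.\<close>
    then have "1 \<le> 2 * \<bar>y\<bar> * (1 / D)"
      using assms by (simp add: field_simps)
    also have "\<dots> \<le> 2 * \<bar>y\<bar> * (E * \<epsilon>)"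
      using assms by (intro mult_left_mono) auto
    also have "\<dots> \<le> 2 * (1 + \<bar>y\<bar>) ^ N * (E * \<epsilon>)"
    proof -
      have "\<bar>y\<bar> \<le> (1 + \<bar>y\<bar>) ^ 1" by simp
      also have "\<dots> \<le> (1 + \<bar>y\<bar>) ^ N" using assms by (intro power_increasing) auto
      finally show ?thesis using assms \<open>0 < \<epsilon>\<close> by (intro mult_right_mono mult_left_mono) auto
    qed
    also have "\<dots> \<le> \<epsilon> * (Q * (1 + \<bar>y\<bar>) ^ N)"
    proof -
      have "2 * E * (\<epsilon> * (1 + \<bar>y\<bar>) ^ N) \<le> Q * (\<epsilon> * (1 + \<bar>y\<bar>) ^ N)"
        using assms \<open>0 < \<epsilon>\<close> by (intro mult_right_mono) (auto simp: Q_def)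
      then show ?thesis by (simp add: algebra_simps)
    qed
    finally have "1 * exp (C + \<kappa> - \<kappa> / 2 * y\<^sup>2)
        \<le> \<epsilon> * (Q * (1 + \<bar>y\<bar>) ^ N) * exp (C + \<kappa> - \<kappa> / 2 * y\<^sup>2)"
      by (intro mult_right_mono) auto
    from order_trans[OF _ this, of "exp (v y)"] v_le'[of y] show ?thesis
      by (simp add: S G_def mult.assoc)
  qed
  have "\<bar>(\<integral>y. S y \<partial>lborel) - (\<integral>y. exp (v y) \<partial>lborel)\<bar> = \<bar>\<integral>y. S y - exp (v y) \<partial>lborel\<bar>"
    using S_int f_int by simp
  also have "\<dots> \<le> (\<integral>y. \<bar>S y - exp (v y)\<bar> \<partial>lborel)"
    by (rule integral_abs_bound)
  also have "\<dots> \<le> (\<integral>y. \<epsilon> * (Q * G y) \<partial>lborel)"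
    using S_int f_int G_int main by (intro integral_mono) auto
  finally show ?thesis
    unfolding S_integral Q_def G_def by simp
qed

section \<open>Growth comparisons and quotients of asymptotic expansions\<close>

lemma eventually_log_sqrt_less:
  fixes C c :: real
  assumes "c > 0"
  shows "\<forall>\<^sub>F n in sequentially. C * (1 + ln (real n) + sqrt (real n)) \<le> c * real n"
proof -
  \<comment> \<open>Replacing C by the positive |C| + 1 makes the comparison independent of the sign
    of C.\<close>
  have "\<forall>\<^sub>F n in sequentially. (\<bar>C\<bar> + 1) * (1 + ln (real n) + sqrt (real n)) \<le> c * real n"
    using assms by real_asymp
  then show ?thesis
    using eventually_ge_at_top[of 1]
  proof eventually_elim
    case (elim n)
    have "C * (1 + ln (real n) + sqrt (real n)) \<le> (\<bar>C\<bar> + 1) * (1 + ln (real n) + sqrt (real n))"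
      using elim(2) by (intro mult_right_mono) auto
    with elim(1) show ?case by linarith
  qed
qed

lemma eventually_log_powr_less:
  fixes C c p :: real
  assumes "c > 0" "p > 0"
  shows "\<forall>\<^sub>F n in sequentially. C * (1 + ln (real n)) \<le> c * real n powr p"
proof -
  have "\<forall>\<^sub>F n in sequentially. (\<bar>C\<bar> + 1) * (1 + ln (real n)) \<le> c * real n powr p"
    using assms by real_asymp
  then show ?thesis
    using eventually_ge_at_top[of 1]
  proof eventually_elim
    case (elim n)
    have "C * (1 + ln (real n)) \<le> (\<bar>C\<bar> + 1) * (1 + ln (real n))"
      using elim(2) by (intro mult_right_mono) auto
    with elim(1) show ?case by linarith
  qed
qed

text \<open>f/g - p/q = (q (f - p) - p (g - q)) / (g q), and 1 / (g q) stays bounded because g tends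
  to q, which is nonzero.\<close>

lemma bigo_quotient:
  fixes f g \<epsilon> :: "nat \<Rightarrow> real"
  assumes f: "(\<lambda>n. f n - p) \<in> O(\<epsilon>)" and g: "(\<lambda>n. g n - q) \<in> O(\<epsilon>)"
    and \<epsilon>: "\<epsilon> \<longlonglongrightarrow> 0" and "q \<noteq> 0"
  shows "(\<lambda>n. f n / g n - p / q) \<in> O(\<epsilon>)"
proof -
  have "\<epsilon> \<in> o(\<lambda>_. 1)"
    using \<epsilon> by (intro smalloI_tendsto) auto
  then have "(\<lambda>n. g n - q) \<in> o(\<lambda>_. 1)"
    by (rule landau_o.big_small_trans[OF g])
  then have "(\<lambda>n. g n - q) \<longlonglongrightarrow> 0"
    using smalloD_tendsto by fastforce
  then have g_lim: "g \<longlonglongrightarrow> q"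
    by (simp add: LIM_zero_iff)
  have "(\<lambda>n. q * (f n - p)) \<in> O(\<epsilon>)" "(\<lambda>n. p * (g n - q)) \<in> O(\<epsilon>)"
    using f g \<open>q \<noteq> 0\<close> by (simp, cases "p = 0") simp_all
  then have 1: "(\<lambda>n. q * (f n - p) - p * (g n - q)) \<in> O(\<epsilon>)"
    by (rule sum_in_bigo)
  have "(\<lambda>n. 1 / (g n * q)) \<longlonglongrightarrow> 1 / (q * q)"
    using g_lim \<open>q \<noteq> 0\<close> by (intro tendsto_intros) auto
  then have "(\<lambda>n. 1 / (g n * q)) \<in> O(\<lambda>_. 1)"
    by (intro bigoI_tendsto[where c = "1 / (q * q)"]) auto
  from landau_o.big.mult[OF 1 this]
  have 2: "(\<lambda>n. (q * (f n - p) - p * (g n - q)) * (1 / (g n * q))) \<in> O(\<epsilon>)"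
    by simp
  have "\<forall>\<^sub>F n in sequentially. g n \<noteq> 0"
    using g_lim \<open>q \<noteq> 0\<close> by (rule tendsto_imp_eventually_ne)
  then have "\<forall>\<^sub>F n in sequentially.
      f n / g n - p / q = (q * (f n - p) - p * (g n - q)) * (1 / (g n * q))"
    by eventually_elim (use \<open>q \<noteq> 0\<close> in \<open>simp add: field_simps\<close>)
  from landau_o.big.in_cong[OF this] 2 show ?thesis by blast
qed

text \<open>The law is prescribed on k \<le> n only; since these weights already sum to 1, larger
  values of X form a null event.\<close>

lemma prob_eq_sum_weights:
  fixes X :: "'w \<Rightarrow> nat" and p :: "nat \<Rightarrow> real"
  assumes "prob_space M" and X: "X \<in> measurable M (count_space UNIV)"
    and p: "\<And>k. k \<le> n \<Longrightarrow> \<P>(\<omega> in M. X \<omega> = k) = p k" "(\<Sum>k\<le>n. p k) = 1"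
  shows "\<P>(\<omega> in M. Q (X \<omega>)) = (\<Sum>k | k \<le> n \<and> Q k. p k)"
proof -
  interpret prob_space M by fact
  have meas: "{\<omega> \<in> space M. P (X \<omega>)} \<in> sets M" for P
    using measurable_sets[OF X, of "{k. P k}"] by (simp add: vimage_def Int_def conj_commute)
  have finsum: "\<P>(\<omega> in M. X \<omega> \<le> n \<and> P (X \<omega>)) = (\<Sum>k | k \<le> n \<and> P k. p k)" for P
  proof -
    have "{\<omega> \<in> space M. X \<omega> \<le> n \<and> P (X \<omega>)} = (\<Union>k\<in>{k. k \<le> n \<and> P k}. {\<omega> \<in> space M. X \<omega> = k})"
      by auto
    also have "prob \<dots> = (\<Sum>k | k \<le> n \<and> P k. \<P>(\<omega> in M. X \<omega> = k))"
      using meas by (intro finite_measure_finite_Union) (auto simp: disjoint_family_on_def)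
    also have "\<dots> = (\<Sum>k | k \<le> n \<and> P k. p k)"
      by (intro sum.cong) (auto simp: p(1))
    finally show ?thesis .
  qed
  have "\<P>(\<omega> in M. X \<omega> \<le> n) = 1"
    using finsum[of "\<lambda>_. True"] p(2) by (simp add: atMost_def)
  then have "AE \<omega> in M. X \<omega> \<le> n"
    using meas by (simp add: prob_Collect_eq_1)
  then have "\<P>(\<omega> in M. Q (X \<omega>)) = \<P>(\<omega> in M. X \<omega> \<le> n \<and> Q (X \<omega>))"
    using meas by (intro finite_measure_eq_AE) auto
  with finsum show ?thesis by simp
qed

section \<open>Concentration near the maximizers\<close>

text \<open>(A4) stays outside because its \<open>\<nu>\<close> is quantified within the conclusion
  of the theorem.\<close>

locale gibbs_maximizers =
  fixes mstar :: nat
    and An Bn :: "nat \<Rightarrow> real \<Rightarrow> real"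
    and A B :: "real \<Rightarrow> real"
    and J :: "'j set"
    and a :: "'j \<Rightarrow> real"
    and m :: "'j \<Rightarrow> nat"
    and \<epsilon>star \<delta>star Cstar :: real
  assumes mstar: "mstar \<ge> 1"
    and eps: "\<epsilon>star > 0" and del: "\<delta>star > 0" and Cstar: "Cstar > 0"
    and finite_J: "finite J" and m_ge: "\<And>j. j \<in> J \<Longrightarrow> m j \<ge> 1"
    and A_smooth: "C_k_on (2 * mstar + 1) A {0..1}" and B_smooth: "C_k_on 2 B {0..1}"
    and A1: "cond_A1 A J a m mstar \<delta>star"
    and A2: "cond_A2 An Bn A J a \<epsilon>star \<delta>star Cstar"
    and A3: "cond_A3 An Bn A B J a \<delta>star Cstar"
begin

abbreviation H :: "nat \<Rightarrow> nat \<Rightarrow> real" where "H \<equiv> H_fun mstar An Bn"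

abbreviation rate :: "nat \<Rightarrow> real" where "rate n \<equiv> real n powr (1 / (2 * real mstar))"

section \<open>Maximizers of A and the geometry of the wells\<close>

definition Amax :: real where "Amax = (SUP x\<in>{0..1}. A x)"

definition Bmax :: real where "Bmax = Max ((\<lambda>k. B (a k)) ` J)"

lemma sigma_star_eq: "n \<ge> 1 \<Longrightarrow> real n * sigma_star mstar n = rate n"
  by (simp add: sigma_star_def powr_mult_base)

lemma H_eq: "n \<ge> 1 \<Longrightarrow> H n k = real n * An n (real k / real n) + rate n * Bn n (real k / real n)"
  by (simp add: H_fun_def sigma_star_eq)

lemma rate_le_sqrt: "n \<ge> 1 \<Longrightarrow> rate n \<le> sqrt (real n)"
  using mstar by (subst powr_half_sqrt[symmetric]) (auto intro!: powr_mono simp: field_simps)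

lemma rate_ge_1: "n \<ge> 1 \<Longrightarrow> rate n \<ge> 1"
  using mstar by (simp add: ge_one_powr_ge_zero)

lemma rate_le: "n \<ge> 1 \<Longrightarrow> rate n \<le> real n"
  using mstar powr_mono[of "1 / (2 * real mstar)" 1 "real n"] by (simp add: field_simps)

lemma A_continuous: "continuous_on {0..1} A"
  using continuous_on_nth_deriv_on[OF A_smooth, of 0] by simp

lemma A_le_Amax: "x \<in> {0..1} \<Longrightarrow> A x \<le> Amax"
  unfolding Amax_def
  by (intro cSUP_upper bounded_imp_bdd_above compact_imp_bounded compact_continuous_image
      A_continuous) auto

lemma A_attains: obtains x where "x \<in> {0..1}" "A x = Amax"
proof -
  obtain x where x: "x \<in> {0..1}" "\<forall>y\<in>{0..1}. A y \<le> A x"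
    using continuous_attains_sup[OF _ _ A_continuous] by auto
  have "Amax = A x"
    unfolding Amax_def using x by (intro cSup_eq_maximum) auto
  with x(1) that show ?thesis by simp
qed

text \<open>Since the maximum is attained, being an arg max is the same as having the value
  \<open>Amax\<close>. Off the points a_j this gives the strict inequality
  \<open>A x < Amax\<close>.\<close>

lemma maximizer_iff: "x \<in> a ` J \<longleftrightarrow> x \<in> {0..1} \<and> A x = Amax"
proof -
  have "{x. is_arg_max A (\<lambda>x. x \<in> {0..1}) x} = a ` J"
    using A1 by (simp add: cond_A1_def)
  then have "x \<in> a ` J \<longleftrightarrow> is_arg_max A (\<lambda>x. x \<in> {0..1}) x"
    by (metis mem_Collect_eq)
  also have "\<dots> \<longleftrightarrow> x \<in> {0..1} \<and> A x = Amax"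
  proof -
    obtain y where y: "y \<in> {0..1}" "A y = Amax" by (rule A_attains)
    show ?thesis
    proof
      assume x: "is_arg_max A (\<lambda>x. x \<in> {0..1}) x"
      then have "\<not> A x < A y"
        using y(1) unfolding is_arg_max_def by blast
      then show "x \<in> {0..1} \<and> A x = Amax"
        using x y A_le_Amax[of x] unfolding is_arg_max_def by auto
    next
      assume "x \<in> {0..1} \<and> A x = Amax"
      then show "is_arg_max A (\<lambda>x. x \<in> {0..1}) x"
        using A_le_Amax unfolding is_arg_max_def by (auto simp: not_less)
    qed
  qed
  finally show ?thesis .
qed

lemma A_maximizer: "j \<in> J \<Longrightarrow> A (a j) = Amax"
  using maximizer_iff[of "a j"] by simp

lemma J_nonempty: "J \<noteq> {}"
proof -
  obtain y where "y \<in> {0..1}" "A y = Amax" by (rule A_attains)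
  then have "y \<in> a ` J" by (simp add: maximizer_iff)
  then show ?thesis by blast
qed

lemma ball_subset: "j \<in> J \<Longrightarrow> \<bar>x - a j\<bar> < \<delta>star \<Longrightarrow> x \<in> {0<..<1}"
proof -
  assume "j \<in> J" "\<bar>x - a j\<bar> < \<delta>star"
  then have "x \<in> {a j - \<delta>star<..<a j + \<delta>star}" by auto
  moreover have "{a j - \<delta>star<..<a j + \<delta>star} \<subseteq> {0<..<1}"
    using A1 \<open>j \<in> J\<close> unfolding cond_A1_def by blast
  ultimately show ?thesis by blast
qed

lemma a_in: "j \<in> J \<Longrightarrow> a j \<in> {0<..<1}"
  using ball_subset[of j "a j"] del by simp

text \<open>(A1) speaks of open intervals; taking closures keeps the closed ones in
  \<open>{0..1}\<close>, possibly touching 0 or 1.\<close>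

lemma delta_ball_subset:
  assumes "j \<in> J" "\<bar>x - a j\<bar> \<le> \<delta>star"
  shows "x \<in> {0..1}"
proof -
  have "{a j - \<delta>star<..<a j + \<delta>star} \<subseteq> {0<..<1}"
    using A1 assms(1) unfolding cond_A1_def by blast
  also have "\<dots> \<subseteq> {0..1}" by auto
  finally have "{a j - \<delta>star<..<a j + \<delta>star} \<subseteq> {0..1}" .
  then have "closure {a j - \<delta>star<..<a j + \<delta>star} \<subseteq> {0..1}"
    by (intro closure_minimal) auto
  then have "{a j - \<delta>star..a j + \<delta>star} \<subseteq> {0..1}"
    using del by simp
  then show ?thesis using assms(2) by (auto simp: abs_le_iff)
qed

text \<open>Otherwise a_i and a_j would be less than \<open>2 * \<delta>star\<close> apart and their
  midpoint would lie in both open intervals. The hypothesis is non-strict to fit the event of radius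
  \<open>\<delta>star\<close>.\<close>

lemma separated:
  assumes "i \<in> J" "j \<in> J" "i \<noteq> j" "\<bar>x - a j\<bar> \<le> \<delta>star"
  shows "\<delta>star \<le> \<bar>x - a i\<bar>"
proof (rule ccontr)
  assume "\<not> ?thesis"
  then have lt: "\<bar>a i - a j\<bar> < 2 * \<delta>star"
    using assms(4) by linarith
  have "(a i + a j) / 2 \<in> {a i - \<delta>star<..<a i + \<delta>star}"
    and "(a i + a j) / 2 \<in> {a j - \<delta>star<..<a j + \<delta>star}"
    using lt by (auto simp: abs_less_iff)
  moreover have "{a i - \<delta>star<..<a i + \<delta>star} \<inter> {a j - \<delta>star<..<a j + \<delta>star} = {}"
    using A1 assms(1-3) by (auto simp: cond_A1_def disjoint_family_on_def)
  ultimately show False by blast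
qed

lemma m_le_mstar: "j \<in> J \<Longrightarrow> m j \<le> mstar"
  using A1 finite_J by (auto simp: cond_A1_def)

lemma B_le_Bmax: "j \<in> J \<Longrightarrow> B (a j) \<le> Bmax"
  using finite_J by (auto simp: Bmax_def)

lemma J1_iff: "j \<in> J1 B J a \<longleftrightarrow> j \<in> J \<and> B (a j) = Bmax"
  by (auto simp: J1_def Bmax_def)

lemma J1_nonempty: "J1 B J a \<noteq> {}"
proof -
  have "Bmax \<in> (\<lambda>k. B (a k)) ` J"
    unfolding Bmax_def using finite_J J_nonempty by (intro Max_in) auto
  then obtain j where "j \<in> J" "B (a j) = Bmax"
    by (metis imageE)
  then show ?thesis
    using J1_iff by (metis empty_iff)
qed

lemma grid_index_close:
  assumes "j \<in> J" "n \<ge> 1"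
  shows "grid_index a n j \<le> n" "\<bar>real (grid_index a n j) / real n - a j\<bar> \<le> 1 / real n"
proof -
  have a: "0 < a j" "a j < 1" using a_in[OF assms(1)] by auto
  have "0 \<le> real n * a j" using a by simp
  then have k: "real (grid_index a n j) = of_int \<lfloor>real n * a j\<rfloor>"
    by (simp add: grid_index_def)
  have "real n * a j \<le> real n * 1"
    using a by (intro mult_left_mono) auto
  then have "real (grid_index a n j) \<le> real n"
    unfolding k by linarith
  then show "grid_index a n j \<le> n" by simp
  have "\<bar>real (grid_index a n j) - real n * a j\<bar> \<le> 1"
    unfolding k by linarith
  then have "\<bar>real (grid_index a n j) - real n * a j\<bar> / real n \<le> 1 / real n"
    by (intro divide_right_mono) auto
  also have "\<bar>real (grid_index a n j) - real n * a j\<bar> / real n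
      = \<bar>(real (grid_index a n j) - real n * a j) / real n\<bar>"
    by simp
  also have "(real (grid_index a n j) - real n * a j) / real n
      = real (grid_index a n j) / real n - a j"
    using assms(2) by (simp add: field_simps)
  finally show "\<bar>real (grid_index a n j) / real n - a j\<bar> \<le> 1 / real n" .
qed

lemma eventually_grid_index_close:
  assumes "j \<in> J" "d > 0"
  shows "\<forall>\<^sub>F n in sequentially. \<bar>real (grid_index a n j) / real n - a j\<bar> < d"
proof -
  have "\<forall>\<^sub>F n in sequentially. 1 / real n < d"
    using assms(2) by real_asymp
  then show ?thesis
    using eventually_ge_at_top[of 1]
  proof eventually_elim
    case (elim n)
    with grid_index_close(2)[OF assms(1) elim(2)] show ?case by linarith
  qed
qed

section \<open>Upper and lower bounds for the exponents \<open>H n k\<close>\<close>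

lemma eventually_A2:
  "\<forall>\<^sub>F n in sequentially. \<forall>k\<le>n. (\<forall>j\<in>J. \<bar>real k / real n - a j\<bar> \<ge> \<delta>star) \<longrightarrow>
     An n (real k / real n) \<le> Amax - \<epsilon>star \<and> \<bar>Bn n (real k / real n)\<bar> \<le> Cstar"
  using A2 by (simp add: cond_A2_def Amax_def)

text \<open>The pointwise part of (A3), obtained with l = k; the bound on differences is kept apart
  in \<open>eventually_A3_diff\<close>.\<close>

lemma eventually_A3:
  "\<forall>\<^sub>F n in sequentially. \<forall>j\<in>J. \<forall>k\<le>n. \<bar>real k / real n - a j\<bar> < \<delta>star \<longrightarrow>
     \<bar>An n (real k / real n) - A (real k / real n)\<bar> \<le> Cstar * (ln (real n) / real n) \<and>
     \<bar>Bn n (real k / real n) - B (real k / real n)\<bar> \<le> Cstar / real n"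
  using A3 unfolding cond_A3_def by (rule eventually_mono) blast

lemma B_bounded: obtains L where "L > 0" "\<And>x. x \<in> {0..1} \<Longrightarrow> \<bar>B x\<bar> \<le> L"
  using nth_deriv_on_bounded[OF B_smooth, of 0] by auto

lemma B_lipschitz:
  obtains L where "L > 0"
    "\<And>x y. x \<in> {0..1} \<Longrightarrow> y \<in> {0..1} \<Longrightarrow> \<bar>B x - B y\<bar> \<le> L * \<bar>x - y\<bar>"
  using C_k_on_lipschitz[OF B_smooth] by auto

text \<open>On the compact set of points at distance at least d from all a_j, A stays below its
  maximum by some \<open>\<eta>\<close>. A far grid point falls under (A3), with gap
  \<open>\<eta>\<close>, or under (A2), with gap \<open>\<epsilon>star\<close>. The perturbation is
  O(log n + sqrt n), as \<open>rate n \<le> sqrt n\<close>, and consumes half of the gap times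
  n.\<close>

lemma H_upper_far:
  assumes "0 < d"
  obtains c where "c > 0" "\<forall>\<^sub>F n in sequentially. \<forall>k\<le>n.
    (\<forall>j\<in>J. \<bar>real k / real n - a j\<bar> > d) \<longrightarrow> H n k \<le> real n * Amax - c * real n"
proof -
  define K where "K = {0..1} \<inter> (\<Inter>j\<in>J. {x. d \<le> \<bar>x - a j\<bar>})"
  have "closed {x. d \<le> \<bar>x - a j\<bar>}" for j
    by (intro closed_Collect_le continuous_intros)
  then have "compact K"
    unfolding K_def by (intro compact_Int_closed closed_INT) auto
  obtain \<eta> where \<eta>: "\<eta> > 0" "\<And>x. x \<in> K \<Longrightarrow> A x \<le> Amax - \<eta>"
  proof (cases "K = {}")
    case True
    then show ?thesis using that[of 1] by auto
  next
    case False
    have "continuous_on K A"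
      using A_continuous by (rule continuous_on_subset) (auto simp: K_def)
    then obtain x where x: "x \<in> K" "\<forall>y\<in>K. A y \<le> A x"
      using continuous_attains_sup[OF \<open>compact K\<close> False] by blast
    have "x \<notin> a ` J" using x(1) assms by (auto simp: K_def)
    then have "A x < Amax"
      using maximizer_iff[of x] A_le_Amax[of x] x(1) by (auto simp: K_def)
    then show ?thesis using that[of "Amax - A x"] x(2) by auto
  qed
  obtain Lb where Lb: "Lb > 0" "\<And>x. x \<in> {0..1} \<Longrightarrow> \<bar>B x\<bar> \<le> Lb"
    using B_bounded by blast
  define e where "e = min \<eta> \<epsilon>star"
  have e: "e > 0" "e \<le> \<eta>" "e \<le> \<epsilon>star" using \<eta> eps by (auto simp: e_def)
  define C where "C = Cstar + Lb"
  have C: "C > 0" "Cstar \<le> C" using Cstar Lb by (auto simp: C_def)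
  have "\<forall>\<^sub>F n in sequentially. \<forall>k\<le>n.
    (\<forall>j\<in>J. \<bar>real k / real n - a j\<bar> > d) \<longrightarrow> H n k \<le> real n * Amax - e / 2 * real n"
    using eventually_log_sqrt_less[OF half_gt_zero[OF e(1)], of C] eventually_A2 eventually_A3
      eventually_ge_at_top[of 1]
  proof eventually_elim
    case (elim n)
    show ?case
    proof (intro allI impI)
      fix k assume k: "k \<le> n" and far: "\<forall>j\<in>J. \<bar>real k / real n - a j\<bar> > d"
      define x where "x = real k / real n"
      have x01: "x \<in> {0..1}" using k elim by (simp add: x_def)
      have l0: "0 \<le> ln (real n)" using elim by simp
      have key: "An n x \<le> Amax - e + Cstar * (ln (real n) / real n)" "Bn n x \<le> C"
      proof -
        show "An n x \<le> Amax - e + Cstar * (ln (real n) / real n)"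
        proof (cases "\<forall>j\<in>J. \<bar>x - a j\<bar> \<ge> \<delta>star")
          case True
          then have "An n x \<le> Amax - \<epsilon>star"
            using elim(2) k unfolding x_def by blast
          moreover have "0 \<le> Cstar * (ln (real n) / real n)" using l0 Cstar by simp
          ultimately show ?thesis using e by linarith
        next
          case False
          then have "\<bar>An n x - A x\<bar> \<le> Cstar * (ln (real n) / real n)"
            using elim(3) k unfolding x_def by (meson not_le)
          moreover have "x \<in> K" using far x01 by (auto simp: K_def x_def less_imp_le)
          ultimately show ?thesis using \<eta>(2)[of x] e by linarith
        qed
        show "Bn n x \<le> C"
        proof (cases "\<forall>j\<in>J. \<bar>x - a j\<bar> \<ge> \<delta>star")
          case True
          then have "\<bar>Bn n x\<bar> \<le> Cstar"
            using elim(2) k unfolding x_def by blast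
          then show ?thesis using C by linarith
        next
          case False
          then have "\<bar>Bn n x - B x\<bar> \<le> Cstar / real n"
            using elim(3) k unfolding x_def by (meson not_le)
          moreover have "Cstar / real n \<le> Cstar"
            using elim(4) Cstar by (simp add: field_simps)
          ultimately show ?thesis using Lb(2)[OF x01] by (simp add: C_def)
        qed
      qed
      have "real n * An n x \<le> real n * (Amax - e + Cstar * (ln (real n) / real n))"
        using key by (intro mult_left_mono) auto
      also have "\<dots> = real n * Amax - e * real n + Cstar * ln (real n)"
        using elim by (simp add: algebra_simps)
      finally have 1: "real n * An n x \<le> real n * Amax - e * real n + Cstar * ln (real n)" .
      have "rate n * Bn n x \<le> rate n * C"
        using key by (intro mult_left_mono) auto
      also have "\<dots> \<le> sqrt (real n) * C"
        using rate_le_sqrt elim C by (intro mult_right_mono) auto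
      finally have "H n k \<le> real n * Amax - e * real n + Cstar * ln (real n) + sqrt (real n) * C"
        using 1 H_eq[OF elim(4)] by (simp add: x_def)
      moreover have "Cstar * ln (real n) \<le> C * ln (real n)"
        using C l0 by (intro mult_right_mono) auto
      moreover have "C * (1 + ln (real n) + sqrt (real n)) = C + C * ln (real n) + sqrt (real n) * C"
        by (simp add: algebra_simps)
      moreover have "e * real n = e / 2 * real n + e / 2 * real n" by simp
      ultimately show "H n k \<le> real n * Amax - e / 2 * real n"
        using elim(1) C(1) by linarith
    qed
  qed
  then show ?thesis using that[of "e / 2"] e(1) by simp
qed

text \<open>Bounds one weight, and hence the partition function, from below. The grid point is
  within 1/n of a_j, so Lipschitz bounds on A and B cost O(1) after multiplication by n or
  \<open>rate n\<close>; the logarithm comes from (A3).\<close>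

lemma H_lower_grid_index:
  assumes "j \<in> J"
  obtains C where "\<forall>\<^sub>F n in sequentially.
    H n (grid_index a n j) \<ge> real n * Amax + rate n * B (a j) - C * (1 + ln (real n))"
proof -
  obtain LA where LA: "LA > 0"
    "\<And>x y. x \<in> {0..1} \<Longrightarrow> y \<in> {0..1} \<Longrightarrow> \<bar>A x - A y\<bar> \<le> LA * \<bar>x - y\<bar>"
    using C_k_on_lipschitz[OF A_smooth] by auto
  obtain LB where LB: "LB > 0"
    "\<And>x y. x \<in> {0..1} \<Longrightarrow> y \<in> {0..1} \<Longrightarrow> \<bar>B x - B y\<bar> \<le> LB * \<bar>x - y\<bar>"
    using B_lipschitz by blast
  define C where "C = LA + LB + 2 * Cstar"
  have "\<forall>\<^sub>F n in sequentially.
    H n (grid_index a n j) \<ge> real n * Amax + rate n * B (a j) - C * (1 + ln (real n))"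
    using eventually_A3 eventually_grid_index_close[OF assms del] eventually_ge_at_top[of 1]
  proof eventually_elim
    case (elim n)
    define x where "x = real (grid_index a n j) / real n"
    note g = grid_index_close[OF assms elim(3)]
    have x01: "x \<in> {0..1}" "a j \<in> {0..1}"
      using g(1) elim(3) a_in[OF assms] by (auto simp: x_def)
    have "\<bar>A x - A (a j)\<bar> \<le> LA * (1 / real n)"
      using g(2) LA by (intro order_trans[OF LA(2)[OF x01]] mult_left_mono) (auto simp: x_def)
    moreover have "\<bar>An n x - A x\<bar> \<le> Cstar * (ln (real n) / real n)"
      using elim(1,2) g(1) assms unfolding x_def by blast
    ultimately have "An n x \<ge> Amax - LA * (1 / real n) - Cstar * (ln (real n) / real n)"
      using A_maximizer[OF assms] by linarith
    then have "real n * An n x \<ge> real n * (Amax - LA * (1 / real n) - Cstar * (ln (real n) / real n))"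
      by (intro mult_left_mono) auto
    also have "real n * (Amax - LA * (1 / real n) - Cstar * (ln (real n) / real n))
        = real n * Amax - LA - Cstar * ln (real n)"
      using elim(3) by (simp add: algebra_simps)
    finally have 1: "real n * An n x \<ge> real n * Amax - LA - Cstar * ln (real n)" .
    have "\<bar>B x - B (a j)\<bar> \<le> LB * (1 / real n)"
      using g(2) LB by (intro order_trans[OF LB(2)[OF x01]] mult_left_mono) (auto simp: x_def)
    moreover have "\<bar>Bn n x - B x\<bar> \<le> Cstar / real n"
      using elim(1,2) g(1) assms unfolding x_def by blast
    ultimately have "Bn n x \<ge> B (a j) - (LB + Cstar) / real n"
      by (simp add: add_divide_distrib)
    then have "rate n * Bn n x \<ge> rate n * (B (a j) - (LB + Cstar) / real n)"
      by (intro mult_left_mono) auto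
    moreover have "rate n * ((LB + Cstar) / real n) \<le> real n * ((LB + Cstar) / real n)"
      using rate_le[OF elim(3)] LB Cstar by (intro mult_right_mono) auto
    moreover have "real n * ((LB + Cstar) / real n) = LB + Cstar"
      using elim(3) by simp
    ultimately have 2: "rate n * Bn n x \<ge> rate n * B (a j) - (LB + Cstar)"
      by (simp only: right_diff_distrib)
    have "0 \<le> (LA + LB + Cstar) * ln (real n)" using LA LB Cstar elim(3) by simp
    then have "C * (1 + ln (real n)) \<ge> LA + Cstar * ln (real n) + (LB + Cstar)"
      using Cstar by (simp add: C_def algebra_simps)
    with 1 2 show ?case
      using H_eq[OF elim(3), of "grid_index a n j"] by (simp add: x_def)
  qed
  then show ?thesis using that by blast
qed

text \<open>Points far from every maximizer lose a multiple of n. The others are near some a_j with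
  j outside J1, where B falls short of \<open>Bmax\<close> by a fixed amount, and that amount times
  \<open>rate n\<close> beats the O(log n) error.\<close>

lemma H_upper_off_J1:
  assumes "0 < d" "d < \<delta>star"
  obtains g where "g > 0" "\<forall>\<^sub>F n in sequentially. \<forall>k\<le>n.
    (\<forall>j\<in>J1 B J a. \<bar>real k / real n - a j\<bar> > d) \<longrightarrow>
      H n k \<le> real n * Amax + rate n * (Bmax - g)"
proof -
  obtain LB where LB: "LB > 0"
    "\<And>x y. x \<in> {0..1} \<Longrightarrow> y \<in> {0..1} \<Longrightarrow> \<bar>B x - B y\<bar> \<le> LB * \<bar>x - y\<bar>"
    using B_lipschitz by blast
  \<comment> \<open>The gap of B is 4g: one g covers the variation of B near a_j, one absorbs the
    O(log n) terms, and at least one is left.\<close>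
  obtain g where g: "g > 0" "\<And>j. j \<in> J - J1 B J a \<Longrightarrow> B (a j) \<le> Bmax - 4 * g"
  proof (cases "J - J1 B J a = {}")
    case True
    then show ?thesis using that[of 1] by auto
  next
    case False
    define M where "M = Max ((\<lambda>j. B (a j)) ` (J - J1 B J a))"
    have "M \<in> (\<lambda>j. B (a j)) ` (J - J1 B J a)"
      unfolding M_def using finite_J False by (intro Max_in) auto
    then have "M < Bmax" using B_le_Bmax by (force simp: J1_iff less_le)
    moreover have "B (a j) \<le> M" if "j \<in> J - J1 B J a" for j
      unfolding M_def using finite_J that by (intro Max_ge) auto
    ultimately show ?thesis using that[of "(Bmax - M) / 4"] by (force simp: field_simps)
  qed
  \<comment> \<open>Within d' of a_j, B varies by at most g; \<open>d' \<le> d\<close> ensures that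
    a maximizer within d' of x is not in J1.\<close>
  define d' where "d' = min d (g / LB)"
  have d': "0 < d'" "d' \<le> d" "LB * d' \<le> g"
    using assms g LB by (auto simp: d'_def min_def field_simps)
  obtain c where c: "c > 0" and far: "\<forall>\<^sub>F n in sequentially. \<forall>k\<le>n.
    (\<forall>j\<in>J. \<bar>real k / real n - a j\<bar> > d') \<longrightarrow> H n k \<le> real n * Amax - c * real n"
    using H_upper_far[OF d'(1)] by blast
  have p: "1 / (2 * real mstar) > 0" using mstar by simp
  have "\<forall>\<^sub>F n in sequentially. \<forall>k\<le>n.
    (\<forall>j\<in>J1 B J a. \<bar>real k / real n - a j\<bar> > d) \<longrightarrow>
      H n k \<le> real n * Amax + rate n * (Bmax - g)"
    using far eventually_A3 eventually_ge_at_top[of 1]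
      eventually_log_powr_less[OF g(1) p, of Cstar]
      eventually_log_sqrt_less[OF c, of "\<bar>Bmax - g\<bar>"]
  proof eventually_elim
    case (elim n)
    have l0: "0 \<le> ln (real n)" using elim by simp
    show ?case
    proof (intro allI impI)
      fix k assume k: "k \<le> n" and off: "\<forall>j\<in>J1 B J a. \<bar>real k / real n - a j\<bar> > d"
      define x where "x = real k / real n"
      have x01: "x \<in> {0..1}" using k elim by (simp add: x_def)
      show "H n k \<le> real n * Amax + rate n * (Bmax - g)"
      proof (cases "\<forall>j\<in>J. \<bar>x - a j\<bar> > d'")
        case True
        then have "H n k \<le> real n * Amax - c * real n"
          using elim(1) k by (simp add: x_def)
        moreover have "- (c * real n) \<le> rate n * (Bmax - g)"
        proof -
          have "\<bar>Bmax - g\<bar> * rate n \<le> \<bar>Bmax - g\<bar> * (1 + ln (real n) + sqrt (real n))"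
            using rate_le_sqrt[OF elim(3)] l0 by (intro mult_left_mono) auto
          also have "\<dots> \<le> c * real n" by (rule elim(5))
          finally have "\<bar>rate n * (Bmax - g)\<bar> \<le> c * real n"
            by (simp add: abs_mult mult.commute)
          then show ?thesis by linarith
        qed
        ultimately show ?thesis by linarith
      next
        case False
        then obtain j where j: "j \<in> J" "\<bar>x - a j\<bar> \<le> d'" by (auto simp: not_less)
        then have "j \<notin> J1 B J a"
          using off d' by (force simp: x_def)
        have lt: "\<bar>x - a j\<bar> < \<delta>star" using j d' assms by linarith
        then have An: "\<bar>An n x - A x\<bar> \<le> Cstar * (ln (real n) / real n)"
          and Bn: "\<bar>Bn n x - B x\<bar> \<le> Cstar / real n"
          using elim(2) k j(1) unfolding x_def by blast+
        have "real n * An n x \<le> real n * (Amax + Cstar * (ln (real n) / real n))"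
          using An A_le_Amax[OF x01] by (intro mult_left_mono) auto
        also have "\<dots> = real n * Amax + Cstar * ln (real n)"
          using elim(3) by (simp add: algebra_simps)
        finally have 1: "real n * An n x \<le> real n * Amax + Cstar * ln (real n)" .
        have "\<bar>B x - B (a j)\<bar> \<le> LB * \<bar>x - a j\<bar>"
          using x01 a_in[OF j(1)] by (intro LB) auto
        also have "\<dots> \<le> LB * d'"
          using j(2) LB by (intro mult_left_mono) auto
        finally have "B x \<le> Bmax - 3 * g"
          using g(2)[of j] j(1) \<open>j \<notin> J1 B J a\<close> d'(3) by auto
        then have "Bn n x \<le> (Bmax - 3 * g) + Cstar / real n" using Bn by linarith
        then have "rate n * Bn n x \<le> rate n * ((Bmax - 3 * g) + Cstar / real n)"
          by (intro mult_left_mono) auto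
        moreover have "rate n * (Cstar / real n) \<le> real n * (Cstar / real n)"
          using rate_le[OF elim(3)] Cstar by (intro mult_right_mono) auto
        ultimately have 2: "rate n * Bn n x \<le> rate n * (Bmax - 3 * g) + Cstar"
          using elim(3) by (simp add: algebra_simps)
        have "H n k \<le> real n * Amax + rate n * (Bmax - 3 * g) + Cstar * (1 + ln (real n))"
          using 1 2 H_eq[OF elim(3), of k] by (simp add: x_def algebra_simps)
        also have "\<dots> \<le> real n * Amax + rate n * (Bmax - 3 * g) + g * rate n"
          using elim(4) by simp
        also have "\<dots> \<le> real n * Amax + rate n * (Bmax - g)"
          using g(1) by (simp add: algebra_simps)
        finally show ?thesis .
      qed
    qed
  qed
  then show ?thesis using that g(1) by blast
qed

section \<open>Laplace asymptotics of a single well\<close>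

text \<open>An inverse length: the well at a_j extends over distances of order
  \<open>1 / width j n\<close>. The exponent is chosen so that n (x - a_j)^(2 m_j) = y^(2 m_j) for y
  = (x - a_j) \<open>width j n\<close>.\<close>

definition width :: "'j \<Rightarrow> nat \<Rightarrow> real" where
  "width j n = real n powr (1 / (2 * real (m j)))"

text \<open>The first term is the precision of (A4). The second is the size, in the rescaled
  variable, of the linear term of \<open>rate n * B\<close>, which the limiting exponent omits when
  m_j < \<open>mstar\<close>.\<close>

definition laplace_error :: "'j \<Rightarrow> nat \<Rightarrow> real" where
  "laplace_error j n = 1 / rate n + (if m j = mstar then 0 else rate n / width j n)"

text \<open>For i, j in J2 the terms with B cancel in \<open>base i n - base j n\<close>, leaving
  the difference that (A4) controls.\<close>

definition base :: "'j \<Rightarrow> nat \<Rightarrow> real" where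
  "base j n = real n * An n (real (grid_index a n j) / real n) + rate n * B (a j)"

lemma width_power: "j \<in> J \<Longrightarrow> n \<ge> 1 \<Longrightarrow> width j n ^ (2 * m j) = real n"
  using m_ge[of j] by (simp add: width_def powr_realpow[symmetric] powr_powr)

lemma width_bounds:
  assumes "j \<in> J" "n \<ge> 1"
  shows "1 \<le> width j n" "rate n \<le> width j n" "width j n * rate n \<le> real n"
proof -
  show "1 \<le> width j n"
    using assms by (simp add: width_def ge_one_powr_ge_zero)
  have m: "1 \<le> real (m j)" "real (m j) \<le> real mstar"
    using m_ge[OF assms(1)] m_le_mstar[OF assms(1)] by auto
  then show "rate n \<le> width j n"
    unfolding width_def using assms by (intro powr_mono) (auto simp: field_simps)
  have "width j n \<le> real n powr (1 / 2)"
    unfolding width_def using assms m by (intro powr_mono) (auto simp: field_simps)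
  then have "width j n \<le> sqrt (real n)"
    using assms by (simp add: powr_half_sqrt)
  then have "width j n * rate n \<le> sqrt (real n) * sqrt (real n)"
    using rate_le_sqrt[OF assms(2)] by (intro mult_mono) auto
  then show "width j n * rate n \<le> real n" by simp
qed

text \<open>All the small quantities here are at most \<open>1 / rate n\<close>: the exponents 1/(2
  mstar) \<le> 1/(2 m_j) \<le> 1/2 give \<open>rate n \<le> width j n\<close> and
  \<open>width j n * rate n \<le> n\<close>.\<close>

lemma laplace_error_bounds:
  assumes "j \<in> J" "n \<ge> 1"
  shows "0 < laplace_error j n" "1 / rate n \<le> laplace_error j n"
    "1 / width j n \<le> laplace_error j n" "width j n / real n \<le> laplace_error j n"
    "1 / real n \<le> laplace_error j n" "rate n / real n \<le> laplace_error j n"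
proof -
  note w = width_bounds[OF assms] and r = rate_ge_1[OF assms(2)]
  have n: "real n > 0" using assms by simp
  show 1: "1 / rate n \<le> laplace_error j n"
    using w r by (simp add: laplace_error_def)
  have "0 < rate n" using r by linarith
  then have "0 < 1 / rate n" by (rule divide_pos_pos[OF zero_less_one])
  with 1 show "0 < laplace_error j n" by linarith
  have "1 / width j n \<le> 1 / rate n"
    using w \<open>0 < rate n\<close> by (intro divide_left_mono mult_pos_pos) auto
  with 1 show "1 / width j n \<le> laplace_error j n" by linarith
  have "width j n / real n \<le> 1 / rate n"
    using w r n by (simp add: field_simps)
  with 1 show "width j n / real n \<le> laplace_error j n" by linarith
  have "1 / real n \<le> 1 / rate n"
    using rate_le[OF assms(2)] \<open>0 < rate n\<close> n by (intro divide_left_mono mult_pos_pos) auto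
  with 1 show "1 / real n \<le> laplace_error j n" by linarith
  have "rate n / real n \<le> width j n / real n"
    using w(2) n by (intro divide_right_mono) auto
  with \<open>width j n / real n \<le> laplace_error j n\<close> show "rate n / real n \<le> laplace_error j n"
    by linarith
qed

text \<open>By (A1) the remainder of order 2 m_j has a coefficient at most \<open>- \<kappa>\<close>
  on the whole well, and it is bounded; this gives the estimates of order 2 m_j. One more
  derivative, bounded because A is C^(2 mstar + 1) and m_j \<le> mstar, gives the expansion.\<close>

lemma A_near_maximizer:
  assumes j: "j \<in> J" and d: "0 < d" "d < \<delta>star"
  obtains \<kappa> D where "\<kappa> > 0" "D > 0" "c_coef A a m j \<le> - \<kappa>"
    "\<And>x. \<bar>x - a j\<bar> \<le> d \<Longrightarrow> A x - Amax \<le> - \<kappa> * (x - a j) ^ (2 * m j)"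
    "\<And>x. \<bar>x - a j\<bar> \<le> d \<Longrightarrow> \<bar>A x - Amax\<bar> \<le> D * \<bar>x - a j\<bar> ^ (2 * m j)"
    "\<And>x. \<bar>x - a j\<bar> \<le> d \<Longrightarrow>
       \<bar>A x - Amax - c_coef A a m j * (x - a j) ^ (2 * m j)\<bar> \<le> D * \<bar>x - a j\<bar> ^ (2 * m j + 1)"
proof -
  define M where "M = 2 * m j"
  have M: "0 < M" "Suc M \<le> 2 * mstar + 1"
    using m_ge[OF j] m_le_mstar[OF j] by (auto simp: M_def)
  have flat: "\<forall>i\<in>{1..M - 1}. nth_deriv_on {0..1} i A (a j) = 0"
    and sup: "(SUP x\<in>{a j - \<delta>star..a j + \<delta>star}. nth_deriv_on {0..1} M A x) < 0"
    using A1 j by (auto simp: cond_A1_def M_def)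
  define S where "S = (SUP x\<in>{a j - \<delta>star..a j + \<delta>star}. nth_deriv_on {0..1} M A x)"
  obtain D0 where D0: "D0 > 0" "\<And>x. x \<in> {0..1} \<Longrightarrow> \<bar>nth_deriv_on {0..1} M A x\<bar> \<le> D0"
    using nth_deriv_on_bounded[OF A_smooth, of M] M by auto
  obtain D1 where D1: "D1 > 0" "\<And>x. x \<in> {0..1} \<Longrightarrow> \<bar>nth_deriv_on {0..1} (Suc M) A x\<bar> \<le> D1"
    using nth_deriv_on_bounded[OF A_smooth, of "Suc M"] M by auto
  have in01: "x \<in> {0..1}" if "\<bar>x - a j\<bar> \<le> \<delta>star" for x
    using delta_ball_subset[OF j that] .
  have le_S: "nth_deriv_on {0..1} M A x \<le> S" if "\<bar>x - a j\<bar> \<le> \<delta>star" for x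
    unfolding S_def
  proof (rule cSUP_upper)
    show "x \<in> {a j - \<delta>star..a j + \<delta>star}" using that by (auto simp: abs_le_iff)
    \<comment> \<open>A supremum of an unbounded set of reals would carry no information, so
      boundedness is needed before (A1) can be used pointwise.\<close>
    show "bdd_above (nth_deriv_on {0..1} M A ` {a j - \<delta>star..a j + \<delta>star})"
    proof (rule bdd_aboveI2)
      fix y assume "y \<in> {a j - \<delta>star..a j + \<delta>star}"
      then have "\<bar>y - a j\<bar> \<le> \<delta>star" by (auto simp: abs_le_iff)
      from D0(2)[OF in01[OF this]] show "nth_deriv_on {0..1} M A y \<le> D0" by linarith
    qed
  qed
  define \<kappa> where "\<kappa> = - S / fact M"
  have "\<kappa> > 0" using sup by (simp add: \<kappa>_def S_def divide_neg_pos)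
  define D where "D = D0 + D1"
  have ball: "0 < a j - d" "a j + d < 1" "a j \<in> {a j - d..a j + d}"
    using ball_subset[OF j, of "a j - d"] ball_subset[OF j, of "a j + d"] d by auto
  have x_in: "x \<in> {a j - d..a j + d}" if "\<bar>x - a j\<bar> \<le> d" for x
    using that by (auto simp: abs_le_iff)
  have fact: "1 \<le> (fact k :: real)" for k by simp
  have quot: "\<bar>y / fact k\<bar> \<le> D'" if "\<bar>y\<bar> \<le> D'" for y D' :: real and k
  proof -
    have "\<bar>y / fact k\<bar> \<le> \<bar>y\<bar> / 1"
      unfolding abs_divide using fact[of k] by (intro divide_left_mono) auto
    with that show ?thesis by simp
  qed
  have even: "0 \<le> (x - a j) ^ M" for x
    by (simp add: M_def)
  have 1: "A x - Amax \<le> - \<kappa> * (x - a j) ^ M" "\<bar>A x - Amax\<bar> \<le> D * \<bar>x - a j\<bar> ^ M"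
    if x: "\<bar>x - a j\<bar> \<le> d" for x
  proof -
    obtain \<xi> where \<xi>: "\<xi> \<in> {a j - d..a j + d}"
      "A x = A (a j) + nth_deriv_on {0..1} M A \<xi> / fact M * (x - a j) ^ M"
      using taylor_remainder_flat[OF A_smooth M(1) _ ball x_in[OF x] flat] M by auto
    have \<xi>': "\<bar>\<xi> - a j\<bar> \<le> \<delta>star" using \<xi>(1) d by (auto simp: abs_le_iff)
    have eq: "A x - Amax = nth_deriv_on {0..1} M A \<xi> / fact M * (x - a j) ^ M"
      using \<xi>(2) A_maximizer[OF j] by simp
    have "nth_deriv_on {0..1} M A \<xi> / fact M \<le> - \<kappa>"
      unfolding \<kappa>_def using le_S[OF \<xi>'] by (simp add: divide_right_mono)
    then show "A x - Amax \<le> - \<kappa> * (x - a j) ^ M"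
      unfolding eq using even by (intro mult_right_mono)
    have "\<bar>nth_deriv_on {0..1} M A \<xi> / fact M\<bar> \<le> D"
      using D0(2)[OF in01[OF \<xi>']] D1(1) by (intro quot) (simp add: D_def)
    then show "\<bar>A x - Amax\<bar> \<le> D * \<bar>x - a j\<bar> ^ M"
      unfolding eq abs_mult power_abs by (intro mult_right_mono) auto
  qed
  have 2: "\<bar>A x - Amax - c_coef A a m j * (x - a j) ^ M\<bar> \<le> D * \<bar>x - a j\<bar> ^ (M + 1)"
    if x: "\<bar>x - a j\<bar> \<le> d" for x
  proof -
    obtain \<xi> where \<xi>: "\<xi> \<in> {a j - d..a j + d}"
      "A x = A (a j) + nth_deriv_on {0..1} M A (a j) / fact M * (x - a j) ^ M
        + nth_deriv_on {0..1} (Suc M) A \<xi> / fact (Suc M) * (x - a j) ^ Suc M"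
      using taylor_remainder_flat_Suc[OF A_smooth M ball x_in[OF x] flat] by blast
    have \<xi>': "\<bar>\<xi> - a j\<bar> \<le> \<delta>star" using \<xi>(1) d by (auto simp: abs_le_iff)
    have eq: "A x - Amax - c_coef A a m j * (x - a j) ^ M
        = nth_deriv_on {0..1} (Suc M) A \<xi> / fact (Suc M) * (x - a j) ^ (M + 1)"
      using \<xi>(2) A_maximizer[OF j] by (simp add: c_coef_def M_def)
    have "\<bar>nth_deriv_on {0..1} (Suc M) A \<xi> / fact (Suc M)\<bar> \<le> D"
      using D1(2)[OF in01[OF \<xi>']] D0(1) by (intro quot) (simp add: D_def)
    then show ?thesis
      unfolding eq abs_mult power_abs by (intro mult_right_mono) auto
  qed
  have "c_coef A a m j \<le> - \<kappa>"
    unfolding c_coef_def \<kappa>_def M_def[symmetric]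
    using le_S[of "a j"] del by (simp add: divide_right_mono)
  then show ?thesis
    using that[of \<kappa> D] 1 2 \<open>\<kappa> > 0\<close> D0(1) D1(1) by (simp add: M_def D_def)
qed

lemma B_near_maximizer:
  assumes j: "j \<in> J" and d: "0 < d" "d < \<delta>star"
  obtains D where "D > 0"
    "\<And>x. \<bar>x - a j\<bar> \<le> d \<Longrightarrow>
       \<bar>B x - B (a j) - nth_deriv_on {0..1} 1 B (a j) * (x - a j)\<bar> \<le> D * \<bar>x - a j\<bar> ^ 2"
proof -
  obtain D where D: "D > 0" "\<And>x. x \<in> {0..1} \<Longrightarrow> \<bar>nth_deriv_on {0..1} 2 B x\<bar> \<le> D"
    using nth_deriv_on_bounded[OF B_smooth, of 2] by auto
  have ball: "0 < a j - d" "a j + d < 1" "a j \<in> {a j - d..a j + d}"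
    using ball_subset[OF j, of "a j - d"] ball_subset[OF j, of "a j + d"] d by auto
  have "\<bar>B x - B (a j) - nth_deriv_on {0..1} 1 B (a j) * (x - a j)\<bar> \<le> D * \<bar>x - a j\<bar> ^ 2"
    if "\<bar>x - a j\<bar> \<le> d" for x
  proof -
    have "x \<in> {a j - d..a j + d}" using that by (auto simp: abs_le_iff)
    then obtain \<xi> where \<xi>: "\<xi> \<in> {a j - d..a j + d}"
      "B x = (\<Sum>l<2. nth_deriv_on {0..1} l B (a j) / fact l * (x - a j) ^ l)
        + nth_deriv_on {0..1} 2 B \<xi> / fact 2 * (x - a j) ^ 2"
      using nth_deriv_on_taylor[OF B_smooth _ _ ball, of 2] by auto
    have "(\<Sum>l<2. nth_deriv_on {0..1} l B (a j) / fact l * (x - a j) ^ l)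
        = B (a j) + nth_deriv_on {0..1} 1 B (a j) * (x - a j)"
      by (simp add: lessThan_nat_numeral lessThan_Suc)
    then have eq: "B x - B (a j) - nth_deriv_on {0..1} 1 B (a j) * (x - a j)
        = nth_deriv_on {0..1} 2 B \<xi> / 2 * (x - a j) ^ 2"
      using \<xi>(2) by (simp add: fact_numeral)
    have "\<xi> \<in> {0..1}" using \<xi>(1) ball by auto
    then have "\<bar>nth_deriv_on {0..1} 2 B \<xi> / 2\<bar> \<le> D"
      using D(2)[of \<xi>] D(1) by simp
    then show ?thesis
      unfolding eq abs_mult power_abs by (intro mult_right_mono) auto
  qed
  with D(1) that show ?thesis by blast
qed

definition exponent :: "'j \<Rightarrow> real \<Rightarrow> real" where
  "exponent j y = c_coef A a m j * y ^ (2 * m j) + b_coef B a m mstar j * y"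

lemma eventually_A3_diff:
  "\<forall>\<^sub>F n in sequentially. \<forall>j\<in>J. \<forall>k\<le>n. \<forall>l\<le>n.
     \<bar>real k / real n - a j\<bar> < \<delta>star \<longrightarrow> \<bar>real l / real n - a j\<bar> < \<delta>star \<longrightarrow>
     \<bar>(An n (real k / real n) - An n (real l / real n))
        - (A (real k / real n) - A (real l / real n))\<bar> \<le> Cstar * \<bar>real k - real l\<bar> / (real n)^2"
  using A3 unfolding cond_A3_def by (rule eventually_mono) blast

text \<open>The error in the first estimate is small but grows polynomially in y. The second is
  crude but gives Gaussian decay over the whole well, with the same constants as for the limit
  \<open>exponent j\<close>. Together they are the input of
  \<open>riemann_sum_integral_bound\<close>.\<close>

lemma H_near_maximizer:
  assumes j: "j \<in> J" and d: "0 < d" "d < \<delta>star"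
  obtains \<kappa> C E where "\<kappa> > 0" "E > 0" "\<And>y. exponent j y \<le> C - \<kappa> * y\<^sup>2"
    "\<forall>\<^sub>F n in sequentially. \<forall>k\<le>n. \<bar>real k / real n - a j\<bar> \<le> d \<longrightarrow>
       \<bar>H n k - base j n - exponent j ((real k / real n - a j) * width j n)\<bar>
         \<le> E * laplace_error j n
             * (1 + \<bar>(real k / real n - a j) * width j n\<bar>) ^ (2 * m j + 1) \<and>
       H n k - base j n \<le> C - \<kappa> * ((real k / real n - a j) * width j n)\<^sup>2"
proof -
  define M where "M = 2 * m j"
  have M: "M \<ge> 2" using m_ge[OF j] by (simp add: M_def)
  define c where "c = c_coef A a m j"
  define b where "b = b_coef B a m mstar j"
  define b' where "b' = nth_deriv_on {0..1} 1 B (a j)"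
  obtain \<kappa>0 DA where \<kappa>0: "\<kappa>0 > 0" and DA: "DA > 0" and c: "c \<le> - \<kappa>0"
    and A_up: "\<And>x. \<bar>x - a j\<bar> \<le> d \<Longrightarrow> A x - Amax \<le> - \<kappa>0 * (x - a j) ^ M"
    and A_flat: "\<And>x. \<bar>x - a j\<bar> \<le> d \<Longrightarrow> \<bar>A x - Amax\<bar> \<le> DA * \<bar>x - a j\<bar> ^ M"
    and A_tay: "\<And>x. \<bar>x - a j\<bar> \<le> d \<Longrightarrow>
       \<bar>A x - Amax - c * (x - a j) ^ M\<bar> \<le> DA * \<bar>x - a j\<bar> ^ (M + 1)"
    using A_near_maximizer[OF j d] unfolding c_def M_def by blast
  obtain DB where DB: "DB > 0"
    and B_tay: "\<And>x. \<bar>x - a j\<bar> \<le> d \<Longrightarrow>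
       \<bar>B x - B (a j) - b' * (x - a j)\<bar> \<le> DB * \<bar>x - a j\<bar> ^ 2"
    using B_near_maximizer[OF j d] unfolding b'_def by blast
  obtain LB where LB: "LB > 0"
    "\<And>x y. x \<in> {0..1} \<Longrightarrow> y \<in> {0..1} \<Longrightarrow> \<bar>B x - B y\<bar> \<le> LB * \<bar>x - y\<bar>"
    using B_lipschitz by blast
  \<comment> \<open>Counts the six error terms below: \<open>Cstar\<close> for e1 and e3,
    \<open>DA\<close> for e2 and e4, \<open>DB\<close> for e5, |b'| for e6.\<close>
  define E where "E = 2 * Cstar + 2 * DA + DB + \<bar>b'\<bar>"
  \<comment> \<open>One slope for two linear terms, \<open>LB\<close> for B itself and |b| for the
    limiting exponent.\<close>
  define L where "L = LB + \<bar>b\<bar>"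
  \<comment> \<open>\<open>3 * Cstar + DA\<close> absorbs the crude bounds on e1, e2, e3; the rest
    is the constant of \<open>even_power_quadratic_bound\<close>.\<close>
  define C where "C = 3 * Cstar + DA + \<kappa>0 + L\<^sup>2 / (2 * \<kappa>0)"
  define \<kappa> where "\<kappa> = \<kappa>0 / 2"
  have quad: "- \<kappa>0 * y ^ M + L * \<bar>y\<bar> \<le> C - 3 * Cstar - DA - \<kappa> * y\<^sup>2" for y
    using even_power_quadratic_bound[OF \<kappa>0 m_ge[OF j], of y L] unfolding C_def \<kappa>_def M_def by simp
  have yM: "0 \<le> y ^ M" for y :: real by (simp add: M_def)
  have exponent_le: "exponent j y \<le> C - \<kappa> * y\<^sup>2" for y
  proof -
    have "c * y ^ M \<le> - \<kappa>0 * y ^ M" using c yM by (intro mult_right_mono) auto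
    moreover have "b * y \<le> \<bar>b\<bar> * \<bar>y\<bar>" by (metis abs_ge_self abs_mult)
    moreover have "\<bar>b\<bar> * \<bar>y\<bar> \<le> L * \<bar>y\<bar>" using LB by (intro mult_right_mono) (auto simp: L_def)
    ultimately show ?thesis
      using quad[of y] DA Cstar by (simp add: exponent_def c_def b_def M_def)
  qed
  have ev: "\<forall>\<^sub>F n in sequentially. \<forall>k\<le>n. \<bar>real k / real n - a j\<bar> \<le> d \<longrightarrow>
       \<bar>H n k - base j n - exponent j ((real k / real n - a j) * width j n)\<bar>
         \<le> E * laplace_error j n
             * (1 + \<bar>(real k / real n - a j) * width j n\<bar>) ^ (2 * m j + 1) \<and>
       H n k - base j n \<le> C - \<kappa> * ((real k / real n - a j) * width j n)\<^sup>2"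
    using eventually_A3 eventually_A3_diff eventually_grid_index_close[OF j d(1)]
      eventually_ge_at_top[of 1]
  proof eventually_elim
    case (elim n)
    note n1 = elim(4)
    define \<epsilon> where "\<epsilon> = laplace_error j n"
    note eb = laplace_error_bounds[OF j n1, folded \<epsilon>_def]
    define s where "s = width j n"
    note sb = width_bounds[OF j n1, folded s_def] and sM = width_power[OF j n1, folded s_def M_def]
    define \<rho> where "\<rho> = rate n"
    have \<rho>: "1 \<le> \<rho>" "\<rho> \<le> real n" "\<rho> \<le> s"
      using rate_ge_1[OF n1] rate_le[OF n1] sb by (auto simp: \<rho>_def)
    have n0: "real n > 0" "real n \<ge> 1" and s0: "s > 0" using n1 sb by auto
    define l where "l = grid_index a n j"
    define w where "w = real l / real n"
    have w: "\<bar>w - a j\<bar> \<le> 1 / real n" "\<bar>w - a j\<bar> \<le> d" "l \<le> n"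
      using grid_index_close[OF j n1] elim(3) by (auto simp: w_def l_def)
    show ?case
    proof (intro allI impI)
      fix k assume k: "k \<le> n" and near: "\<bar>real k / real n - a j\<bar> \<le> d"
      define x where "x = real k / real n"
      define z where "z = x - a j"
      define y where "y = z * s"
      have z_eq: "z = y / s" using s0 by (simp add: y_def)
      have nz: "\<bar>z\<bar> \<le> d" using near by (simp add: z_def x_def)
      have x_near: "\<bar>x - a j\<bar> \<le> d" using nz by (simp add: z_def)
      have "\<bar>x - a j\<bar> \<le> \<delta>star" using x_near d by linarith
      then have x01: "x \<in> {0..1}" by (rule delta_ball_subset[OF j])
      have zM: "real n * z ^ M = y ^ M"
        using s0 by (simp add: z_eq power_divide sM) (use n0 in simp)
      define P where "P = (1 + \<bar>y\<bar>) ^ (M + 1)"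
      have pow: "\<bar>y\<bar> ^ i \<le> P" "(1 + \<bar>y\<bar>) \<le> P" if "i \<le> M + 1" for i
      proof -
        have "\<bar>y\<bar> ^ i \<le> (1 + \<bar>y\<bar>) ^ i" by (intro power_mono) auto
        also have "\<dots> \<le> P" unfolding P_def using that by (intro power_increasing) auto
        finally show "\<bar>y\<bar> ^ i \<le> P" .
        have "(1 + \<bar>y\<bar>) ^ 1 \<le> P" unfolding P_def by (intro power_increasing) auto
        then show "(1 + \<bar>y\<bar>) \<le> P" by simp
      qed
      have P1: "1 \<le> P" using pow(1)[of 0] by simp
      \<comment> \<open>e1 and e3 replace A_n and B_n by A and B, e2 accounts for the grid point not
        being a_j, e4 and e5 are Taylor remainders, and e6 is the discrepancy between the linear
        term of B and that of the limit.\<close>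
      define e1 where "e1 = real n * ((An n x - An n w) - (A x - A w))"
      define e2 where "e2 = real n * (A w - Amax)"
      define e3 where "e3 = \<rho> * (Bn n x - B x)"
      define e4 where "e4 = real n * (A x - Amax - c * z ^ M)"
      define e5 where "e5 = \<rho> * (B x - B (a j) - b' * z)"
      define e6 where "e6 = \<rho> * b' * z - b * y"
      have H1: "H n k - base j n = e1 + real n * (A x - Amax) - e2 + e3 + \<rho> * (B x - B (a j))"
        unfolding H_eq[OF n1] base_def x_def[symmetric] l_def[symmetric] w_def[symmetric]
          \<rho>_def[symmetric] e1_def e2_def e3_def
        by (simp add: algebra_simps)
      have H2: "H n k - base j n - exponent j y = e1 - e2 + e3 + e4 + e5 + e6"
        unfolding H1 e4_def e5_def e6_def exponent_def c_def[symmetric] b_def[symmetric]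
          M_def[symmetric] zM[symmetric]
        by (simp add: algebra_simps)
      have lt: "\<bar>real k / real n - a j\<bar> < \<delta>star" "\<bar>real l / real n - a j\<bar> < \<delta>star"
        using near w(2) d by (auto simp: w_def)
      have e1: "\<bar>e1\<bar> \<le> Cstar * (\<bar>z\<bar> + 1 / real n)"
      proof -
        have "\<bar>(An n x - An n w) - (A x - A w)\<bar> \<le> Cstar * \<bar>real k - real l\<bar> / (real n)^2"
          using elim(2) j k w(3) lt unfolding x_def w_def by blast
        then have "\<bar>e1\<bar> \<le> real n * (Cstar * \<bar>real k - real l\<bar> / (real n)^2)"
          unfolding e1_def abs_mult abs_of_nat by (intro mult_left_mono) auto
        also have "\<dots> = Cstar * (\<bar>real k - real l\<bar> / real n)"
          using n0 by (simp add: power2_eq_square)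
        also have "\<bar>real k - real l\<bar> / real n = \<bar>x - w\<bar>"
          by (simp add: x_def w_def diff_divide_distrib[symmetric])
        also have "\<bar>x - w\<bar> \<le> \<bar>z\<bar> + 1 / real n"
          using w(1) by (simp add: z_def)
        finally show ?thesis using Cstar by (simp add: mult_left_mono)
      qed
      have e2: "\<bar>e2\<bar> \<le> DA * (1 / real n)"
      proof -
        have "\<bar>w - a j\<bar> ^ M \<le> (1 / real n) ^ M"
          using w(1) by (intro power_mono) auto
        also have "\<dots> \<le> (1 / real n) ^ 2"
          using M n0 by (intro power_decreasing) auto
        finally have "\<bar>A w - Amax\<bar> \<le> DA * (1 / real n) ^ 2"
          using A_flat[OF w(2)] DA by (meson mult_left_mono less_imp_le order_trans)
        then have "\<bar>e2\<bar> \<le> real n * (DA * (1 / real n) ^ 2)"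
          unfolding e2_def abs_mult abs_of_nat by (intro mult_left_mono) auto
        also have "\<dots> = DA * (1 / real n)"
          using n0 by (simp add: power2_eq_square)
        finally show ?thesis .
      qed
      have e3: "\<bar>e3\<bar> \<le> Cstar * (\<rho> / real n)"
      proof -
        have "\<bar>Bn n x - B x\<bar> \<le> Cstar / real n"
          using elim(1) j k lt unfolding x_def by blast
        then have "\<bar>e3\<bar> \<le> \<rho> * (Cstar / real n)"
          unfolding e3_def abs_mult using \<rho> by (intro mult_mono) auto
        then show ?thesis by (simp add: mult.commute)
      qed
      have e4: "\<bar>e4\<bar> \<le> DA * \<epsilon> * P"
      proof -
        have "\<bar>e4\<bar> \<le> real n * (DA * \<bar>z\<bar> ^ (M + 1))"
          unfolding e4_def abs_mult abs_of_nat z_def using A_tay[OF x_near] by (intro mult_left_mono) auto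
        \<comment> \<open>Since s^M = n, the extra power of z leaves exactly one factor 1 /
          s.\<close>
        also have "\<dots> = DA * ((1 / s) * \<bar>y\<bar> ^ (M + 1))"
          using s0 n0 by (simp add: z_eq power_divide abs_divide sM)
        also have "\<dots> \<le> DA * (\<epsilon> * P)"
          using eb(1,3) pow(1)[of "M + 1"] DA s0 unfolding s_def
          by (intro mult_left_mono mult_mono) auto
        finally show ?thesis by (simp add: mult.assoc)
      qed
      have e5: "\<bar>e5\<bar> \<le> DB * \<epsilon> * P"
      proof -
        have "\<bar>e5\<bar> \<le> \<rho> * (DB * \<bar>z\<bar> ^ 2)"
          unfolding e5_def abs_mult z_def using B_tay[OF x_near] \<rho> by (intro mult_mono) auto
        also have "\<dots> \<le> s * (DB * \<bar>z\<bar> ^ 2)"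
          using \<rho> DB by (intro mult_right_mono) auto
        also have "\<dots> = DB * ((1 / s) * \<bar>y\<bar> ^ 2)"
          using s0 by (simp add: z_eq power2_eq_square)
        also have "\<dots> \<le> DB * (\<epsilon> * P)"
          using eb(1,3) pow(1)[of 2] M DB s0 unfolding s_def
          by (intro mult_left_mono mult_mono) auto
        finally show ?thesis by (simp add: mult.assoc)
      qed
      \<comment> \<open>If m_j = \<open>mstar\<close>, the two scales agree and the linear terms
        coincide. Otherwise b = 0 and the whole term has size
        \<open>rate n / width j n\<close>.\<close>
      have e6: "\<bar>e6\<bar> \<le> \<bar>b'\<bar> * \<epsilon> * P"
      proof (cases "m j = mstar")
        case True
        then have "\<rho> = s" "b = b'"
          by (auto simp: \<rho>_def s_def width_def b_def b'_def b_coef_def)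
        then have "e6 = 0" by (simp add: e6_def y_def)
        then show ?thesis using eb(1) P1 by simp
      next
        case False
        then have "b = 0" by (simp add: b_def b_coef_def)
        then have "\<bar>e6\<bar> = \<bar>b'\<bar> * ((\<rho> / s) * \<bar>y\<bar> ^ 1)"
          using \<rho> s0 by (simp add: e6_def z_eq abs_mult)
        also have "\<rho> / s \<le> \<epsilon>"
          using False \<rho> by (simp add: \<epsilon>_def laplace_error_def \<rho>_def s_def)
        then have "\<bar>b'\<bar> * ((\<rho> / s) * \<bar>y\<bar> ^ 1) \<le> \<bar>b'\<bar> * (\<epsilon> * P)"
          using eb(1) pow(1)[of 1] s0 \<rho> by (intro mult_left_mono mult_mono) auto
        finally show ?thesis by (simp add: mult.assoc)
      qed
      have e1': "\<bar>e1\<bar> \<le> Cstar * \<epsilon> * P"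
      proof -
        have "\<bar>z\<bar> = (1 / s) * \<bar>y\<bar>" using s0 by (simp add: z_eq)
        also have "\<dots> \<le> \<epsilon> * \<bar>y\<bar>" using eb(3) by (intro mult_right_mono) (auto simp: s_def)
        finally have "\<bar>z\<bar> + 1 / real n \<le> \<epsilon> * (1 + \<bar>y\<bar>)"
          using eb(5) by (simp add: distrib_left)
        also have "\<dots> \<le> \<epsilon> * P" using eb(1) pow(2) by (intro mult_left_mono) auto
        finally have "Cstar * (\<bar>z\<bar> + 1 / real n) \<le> Cstar * (\<epsilon> * P)"
          using Cstar by (intro mult_left_mono) auto
        with e1 show ?thesis by (simp add: mult.assoc)
      qed
      have e2': "\<bar>e2\<bar> \<le> DA * \<epsilon> * P"
      proof -
        have "DA * (1 / real n) \<le> DA * (\<epsilon> * P)"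
          using DA eb(1,5) mult_mono[of "1 / real n" \<epsilon> 1 P] P1 by (intro mult_left_mono) auto
        with e2 show ?thesis by (simp add: mult.assoc)
      qed
      have e3': "\<bar>e3\<bar> \<le> Cstar * \<epsilon> * P"
      proof -
        have "Cstar * (\<rho> / real n) \<le> Cstar * (\<epsilon> * P)"
          using Cstar eb(1,6) mult_mono[of "\<rho> / real n" \<epsilon> 1 P] P1 \<rho> unfolding \<rho>_def
          by (intro mult_left_mono) auto
        with e3 show ?thesis by (simp add: mult.assoc)
      qed
      have "E * \<epsilon> * P = 2 * (Cstar * \<epsilon> * P) + 2 * (DA * \<epsilon> * P) + DB * \<epsilon> * P + \<bar>b'\<bar> * \<epsilon> * P"
        by (simp add: E_def algebra_simps)
      then have part1: "\<bar>H n k - base j n - exponent j y\<bar> \<le> E * \<epsilon> * P"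
        unfolding H2 using e1' e2' e3' e4 e5 e6 by linarith
      \<comment> \<open>The crude estimate: e1, e2, e3 are now bounded by constants, and B enters
        only through its Lipschitz bound.\<close>
      have "1 / real n \<le> 1" "\<rho> / real n \<le> 1" using n0 \<rho> by auto
      moreover have "\<bar>z\<bar> \<le> 1"
        using x01 a_in[OF j] by (auto simp: z_def)
      ultimately have "Cstar * (\<bar>z\<bar> + 1 / real n) \<le> Cstar * 2" "DA * (1 / real n) \<le> DA * 1"
        "Cstar * (\<rho> / real n) \<le> Cstar * 1"
        using Cstar DA by (intro mult_left_mono; simp)+
      then have "\<bar>e1\<bar> \<le> 2 * Cstar" "\<bar>e2\<bar> \<le> DA" "\<bar>e3\<bar> \<le> Cstar"
        using e1 e2 e3 by linarith+
      moreover have "real n * (A x - Amax) \<le> - \<kappa>0 * y ^ M"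
      proof -
        have "real n * (A x - Amax) \<le> real n * (- \<kappa>0 * z ^ M)"
          using A_up[OF x_near] n0 by (intro mult_left_mono) (auto simp: z_def)
        also have "\<dots> = - \<kappa>0 * (real n * z ^ M)" by simp
        finally show ?thesis by (simp only: zM)
      qed
      moreover have "\<rho> * (B x - B (a j)) \<le> L * \<bar>y\<bar>"
      proof -
        have "B x - B (a j) \<le> LB * \<bar>z\<bar>"
          using LB(2)[OF x01, of "a j"] a_in[OF j] by (auto simp: z_def)
        then have "\<rho> * (B x - B (a j)) \<le> \<rho> * (LB * \<bar>z\<bar>)"
          using \<rho> by (intro mult_left_mono) auto
        also have "\<dots> \<le> s * (LB * \<bar>z\<bar>)"
          using \<rho> LB by (intro mult_right_mono) auto
        also have "\<dots> = LB * \<bar>y\<bar>" using s0 by (simp add: y_def abs_mult)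
        also have "\<dots> \<le> L * \<bar>y\<bar>" by (intro mult_right_mono) (auto simp: L_def)
        finally show ?thesis .
      qed
      ultimately have part2: "H n k - base j n \<le> C - \<kappa> * y\<^sup>2"
        unfolding H1 using quad[of y] by linarith
      show "\<bar>H n k - base j n - exponent j ((real k / real n - a j) * width j n)\<bar>
         \<le> E * laplace_error j n
             * (1 + \<bar>(real k / real n - a j) * width j n\<bar>) ^ (2 * m j + 1) \<and>
       H n k - base j n \<le> C - \<kappa> * ((real k / real n - a j) * width j n)\<^sup>2"
        using part1 part2 by (simp add: y_def z_def x_def s_def P_def \<epsilon>_def M_def)
    qed
  qed
  have "\<kappa> > 0" "E > 0" using \<kappa>0 DA DB Cstar by (auto simp: \<kappa>_def E_def)
  from that[OF this exponent_le ev] show ?thesis .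
qed

section \<open>From the local expansion to the total weight of a well\<close>

lemma laplace_error_tendsto_0: "j \<in> J \<Longrightarrow> laplace_error j \<longlonglongrightarrow> 0"
proof -
  assume j: "j \<in> J"
  have 1: "(\<lambda>n. real n powr (- (1 / (2 * real mstar)))) \<longlonglongrightarrow> 0"
    using mstar by (intro tendsto_neg_powr filterlim_real_sequentially) simp
  have 2: "(\<lambda>n. if m j = mstar then 0
      else real n powr (1 / (2 * real mstar) - 1 / (2 * real (m j)))) \<longlonglongrightarrow> 0"
  proof (cases "m j = mstar")
    case False
    then have "m j < mstar" using m_le_mstar[OF j] by simp
    then have "1 / (2 * real mstar) - 1 / (2 * real (m j)) < 0"
      using m_ge[OF j] by (simp add: field_simps)
    then show ?thesis
      using False by (auto intro: tendsto_neg_powr filterlim_real_sequentially)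
  qed simp
  have "laplace_error j = (\<lambda>n. real n powr (- (1 / (2 * real mstar)))
      + (if m j = mstar then 0 else real n powr (1 / (2 * real mstar) - 1 / (2 * real (m j)))))"
    by (auto simp: laplace_error_def width_def powr_minus_divide powr_diff fun_eq_iff)
  then show ?thesis using tendsto_add[OF 1 2] by simp
qed

text \<open>A Lipschitz constant of polynomial growth is harmless against the Gaussian. Restricting
  to |p - q| \<le> 1 allows both points to be measured by 1 + |q|.\<close>

lemma exponent_lipschitz:
  assumes j: "j \<in> J"
  obtains L where "L \<ge> 0" "\<And>p q. \<bar>p - q\<bar> \<le> 1 \<Longrightarrow>
    \<bar>exponent j p - exponent j q\<bar> \<le> L * \<bar>p - q\<bar> * (1 + \<bar>q\<bar>) ^ (2 * m j + 1)"
proof -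
  define M where "M = 2 * m j"
  define c where "c = c_coef A a m j"
  define b where "b = b_coef B a m mstar j"
  define L where "L = \<bar>c\<bar> * real M + \<bar>b\<bar>"
  have "\<bar>exponent j p - exponent j q\<bar> \<le> L * \<bar>p - q\<bar> * (1 + \<bar>q\<bar>) ^ (M + 1)"
    if "\<bar>p - q\<bar> \<le> 1" for p q
  proof -
    define P where "P = (1 + \<bar>q\<bar>) ^ (M + 1)"
    have "(max \<bar>p\<bar> \<bar>q\<bar>) ^ (M - 1) \<le> (1 + \<bar>q\<bar>) ^ (M - 1)"
      using that by (intro power_mono) auto
    also have "\<dots> \<le> P" unfolding P_def by (intro power_increasing) auto
    finally have "real M * \<bar>p - q\<bar> * (max \<bar>p\<bar> \<bar>q\<bar>) ^ (M - 1) \<le> real M * \<bar>p - q\<bar> * P"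
      by (intro mult_left_mono) auto
    then have 1: "\<bar>p ^ M - q ^ M\<bar> \<le> real M * \<bar>p - q\<bar> * P"
      using power_diff_abs_le[of p M q] by linarith
    have "1 \<le> P" unfolding P_def by (intro one_le_power) simp
    then have 2: "\<bar>p - q\<bar> * 1 \<le> \<bar>p - q\<bar> * P" by (intro mult_left_mono) auto
    have "exponent j p - exponent j q = c * (p ^ M - q ^ M) + b * (p - q)"
      by (simp add: exponent_def c_def b_def M_def algebra_simps)
    also have "\<bar>\<dots>\<bar> \<le> \<bar>c\<bar> * \<bar>p ^ M - q ^ M\<bar> + \<bar>b\<bar> * \<bar>p - q\<bar>"
      by (metis abs_triangle_ineq abs_mult)
    also have "\<dots> \<le> \<bar>c\<bar> * (real M * \<bar>p - q\<bar> * P) + \<bar>b\<bar> * (\<bar>p - q\<bar> * P)"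
      using 1 2 by (intro add_mono mult_left_mono) auto
    also have "\<dots> = L * \<bar>p - q\<bar> * P" by (simp add: L_def algebra_simps)
    finally show ?thesis by (simp add: P_def)
  qed
  moreover have "L \<ge> 0" by (simp add: L_def)
  ultimately show ?thesis using that by (simp add: M_def)
qed

lemma exponent_continuous: "continuous_on UNIV (exponent j)"
  unfolding exponent_def by (intro continuous_intros)

lemma q_weight_eq: "q_weight A B a m mstar j = (\<integral>y. exp (exponent j y) \<partial>lborel)"
  by (simp add: q_weight_def exponent_def)

lemma q_weight_pos:
  assumes "j \<in> J"
  shows "q_weight A B a m mstar j > 0"
proof -
  have "0 < \<delta>star / 2" "\<delta>star / 2 < \<delta>star" using del by auto
  from H_near_maximizer[OF assms this] obtain \<kappa> C where
    "\<kappa> > 0" "\<And>y. exponent j y \<le> C - \<kappa> * y\<^sup>2"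
    by blast
  then show ?thesis
    unfolding q_weight_eq by (intro integral_exp_pos integrable_exp_le_gaussian exponent_continuous)
qed

definition well_sum :: "real \<Rightarrow> 'j \<Rightarrow> nat \<Rightarrow> real" where
  "well_sum d j n = (\<Sum>k\<in>{k. k \<le> n \<and> \<bar>real k / real n - a j\<bar> \<le> d}. exp (H n k))"

text \<open>In the variable y = (k/n - a_j) \<open>width j n\<close> the normalised sum is a Riemann
  sum of mesh \<open>width j n / n\<close> over the window |y| \<le> d
  \<open>width j n\<close>.\<close>

lemma well_sum_asymptotics:
  assumes j: "j \<in> J" and d: "0 < d" "d < \<delta>star"
  shows "(\<lambda>n. width j n / real n * exp (- base j n) * well_sum d j n - q_weight A B a m mstar j)
           \<in> O(laplace_error j)"
proof -
  obtain \<kappa> C E where \<kappa>: "\<kappa> > 0" and E: "E > 0"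
    and v_le: "\<And>y. exponent j y \<le> C - \<kappa> * y\<^sup>2"
    and near: "\<forall>\<^sub>F n in sequentially. \<forall>k\<le>n. \<bar>real k / real n - a j\<bar> \<le> d \<longrightarrow>
       \<bar>H n k - base j n - exponent j ((real k / real n - a j) * width j n)\<bar>
         \<le> E * laplace_error j n
             * (1 + \<bar>(real k / real n - a j) * width j n\<bar>) ^ (2 * m j + 1) \<and>
       H n k - base j n \<le> C - \<kappa> * ((real k / real n - a j) * width j n)\<^sup>2"
    by (rule H_near_maximizer[OF j d]) (rule that)
  obtain L where L: "L \<ge> 0" and v_lip: "\<And>p q. \<bar>p - q\<bar> \<le> 1 \<Longrightarrow>
    \<bar>exponent j p - exponent j q\<bar> \<le> L * \<bar>p - q\<bar> * (1 + \<bar>q\<bar>) ^ (2 * m j + 1)"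
    using exponent_lipschitz[OF j] by blast
  define N where "N = 2 * m j + 1"
  \<comment> \<open>The summand 1 / d serves the tail: for D = d s one has 1 / D = (1 / d) (1 / s),
    and 1 / s is at most the error rate.\<close>
  define E' where "E' = E + 1 / d"
  have E': "E' > 0" "E \<le> E'" "1 / d \<le> E'" using E d by (auto simp: E'_def intro: add_pos_pos)
  define Q where "Q = (2 ^ N * E' + L + 2 * E') *
          (\<integral>y. (1 + \<bar>y\<bar>) ^ N * exp (C + \<kappa> - \<kappa> / 2 * y\<^sup>2) \<partial>lborel)"
  have big: "\<forall>\<^sub>F n in sequentially. 2 \<le> d * width j n"
  proof -
    have "filterlim (\<lambda>n. d * width j n) at_top sequentially"
      unfolding width_def using d m_ge[OF j] by real_asymp
    then show ?thesis by (simp add: filterlim_at_top)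
  qed
  have ball: "0 < a j - d" "a j + d < 1"
    using ball_subset[OF j, of "a j - d"] ball_subset[OF j, of "a j + d"] d by auto
  have "\<forall>\<^sub>F n in sequentially.
    norm (width j n / real n * exp (- base j n) * well_sum d j n - q_weight A B a m mstar j)
      \<le> Q * norm (laplace_error j n)"
    using near big eventually_ge_at_top[of 1]
  proof eventually_elim
    case (elim n)
    note n1 = elim(3)
    define \<epsilon> where "\<epsilon> = laplace_error j n"
    note eb = laplace_error_bounds[OF j n1, folded \<epsilon>_def]
    define s where "s = width j n"
    note sb = width_bounds[OF j n1, folded s_def]
    define h where "h = s / real n"
    define t where "t = real n * a j"
    have n0: "real n > 0" and s0: "s > 0" using n1 sb by auto
    have y: "h * (real k - t) = (real k / real n - a j) * s" for k
      using n0 by (simp add: h_def t_def field_simps)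
    \<comment> \<open>The bound k \<le> n is automatic in the window because a_j + d < 1.\<close>
    have K: "{k. \<bar>h * (real k - t)\<bar> \<le> d * s} = {k. k \<le> n \<and> \<bar>real k / real n - a j\<bar> \<le> d}"
    proof -
      have "k \<le> n" if "\<bar>real k / real n - a j\<bar> \<le> d" for k
      proof -
        have "real k / real n \<le> 1" using that ball by linarith
        then show ?thesis using n0 by simp
      qed
      then show ?thesis using s0 by (auto simp: y abs_mult)
    qed
    have "\<bar>h * (\<Sum>k\<in>{k. \<bar>h * (real k - t)\<bar> \<le> d * s}. exp (H n k - base j n))
        - (\<integral>y. exp (exponent j y) \<partial>lborel)\<bar> \<le> \<epsilon> * Q"
      unfolding Q_def
    proof (rule riemann_sum_integral_bound)
      show "0 < h" using n0 s0 by (simp add: h_def)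
      have "s * 1 \<le> s * rate n" using rate_ge_1[OF n1] s0 by (intro mult_left_mono) auto
      then have "s \<le> real n" using sb(3) by linarith
      then show "h \<le> 1" using n0 by (simp add: h_def)
      show "h \<le> \<epsilon>" using eb by (simp add: h_def s_def)
      show "2 \<le> d * s" using elim(2) by (simp add: s_def)
      have "d * s \<le> a j * s" using ball s0 by (intro mult_right_mono) auto
      then show "d * s \<le> h * t" using n0 by (simp add: h_def t_def mult.commute)
      have "1 / (d * s) = 1 / d * (1 / s)" by simp
      also have "\<dots> \<le> E' * \<epsilon>" using E' eb d s0 by (intro mult_mono) (auto simp: s_def)
      finally show "1 / (d * s) \<le> E' * \<epsilon>" .
      show "1 \<le> N" by (simp add: N_def)
    next
      fix k assume "k \<in> {k. \<bar>h * (real k - t)\<bar> \<le> d * s}"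
      then have k: "k \<le> n" "\<bar>real k / real n - a j\<bar> \<le> d" by (auto simp: K)
      have "E * \<epsilon> * (1 + \<bar>(real k / real n - a j) * s\<bar>) ^ N
          \<le> E' * \<epsilon> * (1 + \<bar>(real k / real n - a j) * s\<bar>) ^ N"
        using E' eb by (intro mult_right_mono) auto
      then show "\<bar>H n k - base j n - exponent j (h * (real k - t))\<bar>
          \<le> E' * \<epsilon> * (1 + \<bar>h * (real k - t)\<bar>) ^ N"
        using elim(1) k unfolding y \<epsilon>_def N_def s_def by fastforce
      show "H n k - base j n \<le> C - \<kappa> * (h * (real k - t))\<^sup>2"
        using elim(1) k unfolding y s_def by blast
    qed (use \<kappa> L E' v_le v_lip exponent_continuous in \<open>auto simp: N_def\<close>)
    moreover have "h * (\<Sum>k\<in>{k. \<bar>h * (real k - t)\<bar> \<le> d * s}. exp (H n k - base j n))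
        = width j n / real n * exp (- base j n) * well_sum d j n"
    proof -
      have "exp (H n k - base j n) = exp (- base j n) * exp (H n k)" for k
        by (simp add: exp_add[symmetric])
      then show ?thesis
        unfolding K well_sum_def by (simp add: h_def s_def sum_distrib_left[symmetric])
    qed
    ultimately show ?case
      using eb(1) by (simp add: q_weight_eq \<epsilon>_def mult.commute)
  qed
  then show ?thesis by (rule bigoI)
qed

section \<open>Gibbs probabilities\<close>

text \<open>The law of X_n as a ratio of finite sums, so that the estimates need no probability
  space.\<close>

definition gibbs_prob :: "nat \<Rightarrow> (nat \<Rightarrow> bool) \<Rightarrow> real" where
  "gibbs_prob n Q = (\<Sum>k | k \<le> n \<and> Q k. exp (H n k)) / Z_fun mstar An Bn n"

lemma Z_fun_pos: "Z_fun mstar An Bn n > 0"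
  unfolding Z_fun_def by (intro sum_pos) auto

lemma gibbs_prob_nonneg: "gibbs_prob n Q \<ge> 0"
  unfolding gibbs_prob_def by (intro divide_nonneg_pos Z_fun_pos sum_nonneg) auto

lemma gibbs_prob_mono:
  assumes "\<And>k. k \<le> n \<Longrightarrow> P k \<Longrightarrow> Q k"
  shows "gibbs_prob n P \<le> gibbs_prob n Q"
  unfolding gibbs_prob_def
  using assms Z_fun_pos[of n] by (intro divide_right_mono sum_mono2) auto

lemma gibbs_prob_True: "gibbs_prob n (\<lambda>k. True) = 1"
proof -
  have "{k. k \<le> n \<and> True} = {0..n}" by auto
  then show ?thesis
    using Z_fun_pos[of n] by (simp add: gibbs_prob_def Z_fun_def)
qed

lemma gibbs_prob_disjoint:
  assumes "\<And>k. k \<le> n \<Longrightarrow> \<not> (P k \<and> Q k)"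
  shows "gibbs_prob n (\<lambda>k. P k \<or> Q k) = gibbs_prob n P + gibbs_prob n Q"
proof -
  have "{k. k \<le> n \<and> (P k \<or> Q k)} = {k. k \<le> n \<and> P k} \<union> {k. k \<le> n \<and> Q k}" by auto
  moreover have "{k. k \<le> n \<and> P k} \<inter> {k. k \<le> n \<and> Q k} = {}" using assms by auto
  ultimately show ?thesis
    by (simp add: gibbs_prob_def sum.union_disjoint add_divide_distrib)
qed

lemma gibbs_prob_le_1: "gibbs_prob n Q \<le> 1"
  using gibbs_prob_mono[of n Q "\<lambda>k. True"] gibbs_prob_True[of n] by simp

text \<open>The numerator has at most n + 1 \<le> e n terms, and the denominator is at least its
  single term at l.\<close>

lemma gibbs_prob_le_exp:
  assumes "\<And>k. k \<le> n \<Longrightarrow> Q k \<Longrightarrow> H n k \<le> U" "l \<le> n" "n \<ge> 1"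
  shows "gibbs_prob n Q \<le> exp (1 + ln (real n) + U - H n l)"
proof -
  have "(\<Sum>k | k \<le> n \<and> Q k. exp (H n k)) \<le> real (card {k. k \<le> n \<and> Q k}) * exp U"
    using assms(1) by (intro sum_bounded_above) auto
  also have "\<dots> \<le> real (card {..n}) * exp U"
    by (intro mult_right_mono of_nat_mono card_mono) auto
  also have "real (card {..n}) \<le> exp (1 + ln (real n))"
  proof -
    have "real n + 1 \<le> exp 1 * real n"
    proof -
      have "real n + 1 \<le> 2 * real n" using assms(3) by simp
      also have "\<dots> \<le> exp 1 * real n"
        using exp_ge_add_one_self[of 1] by (intro mult_right_mono) auto
      finally show ?thesis .
    qed
    then show ?thesis using assms(3) by (simp add: exp_add)
  qed
  finally have num: "(\<Sum>k | k \<le> n \<and> Q k. exp (H n k)) \<le> exp (1 + ln (real n)) * exp U"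
    by (simp add: mult_right_mono)
  have den: "exp (H n l) \<le> Z_fun mstar An Bn n"
    unfolding Z_fun_def using assms(2) by (intro member_le_sum) auto
  have "gibbs_prob n Q \<le> exp (1 + ln (real n)) * exp U / exp (H n l)"
    unfolding gibbs_prob_def using num den by (intro frac_le) auto
  then show ?thesis by (simp add: exp_add[symmetric] exp_diff)
qed

text \<open>Any maximizer serves as reference point: its value of B shifts the exponent by O(sqrt n)
  only, negligible against c n.\<close>

lemma gibbs_prob_far:
  assumes "0 < d"
  obtains c where "c > 0" "\<forall>\<^sub>F n in sequentially.
    gibbs_prob n (\<lambda>k. \<forall>j\<in>J. \<bar>real k / real n - a j\<bar> > d) \<le> exp (- c * real n)"
proof -
  obtain c where c: "c > 0" and far: "\<forall>\<^sub>F n in sequentially. \<forall>k\<le>n.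
    (\<forall>j\<in>J. \<bar>real k / real n - a j\<bar> > d) \<longrightarrow> H n k \<le> real n * Amax - c * real n"
    by (rule H_upper_far[OF assms]) (rule that)
  obtain i where i: "i \<in> J" using J_nonempty by blast
  obtain C where low: "\<forall>\<^sub>F n in sequentially.
    H n (grid_index a n i) \<ge> real n * Amax + rate n * B (a i) - C * (1 + ln (real n))"
    by (rule H_lower_grid_index[OF i]) (rule that)
  define C' where "C' = 1 + \<bar>C\<bar> + \<bar>B (a i)\<bar>"
  have "\<forall>\<^sub>F n in sequentially.
    gibbs_prob n (\<lambda>k. \<forall>j\<in>J. \<bar>real k / real n - a j\<bar> > d) \<le> exp (- (c / 2) * real n)"
    using far low eventually_log_sqrt_less[OF half_gt_zero[OF c], of C'] eventually_ge_at_top[of 1]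
  proof eventually_elim
    case (elim n)
    have l0: "0 \<le> ln (real n)" using elim by simp
    have "gibbs_prob n (\<lambda>k. \<forall>j\<in>J. \<bar>real k / real n - a j\<bar> > d)
        \<le> exp (1 + ln (real n) + (real n * Amax - c * real n) - H n (grid_index a n i))"
      using elim(1) grid_index_close(1)[OF i elim(4)] elim(4) by (intro gibbs_prob_le_exp) auto
    also have "\<dots> \<le> exp (- (c / 2) * real n)"
    proof -
      have "- (rate n * B (a i)) \<le> rate n * \<bar>B (a i)\<bar>"
        by (metis abs_ge_minus_self abs_mult abs_of_nonneg powr_ge_zero)
      also have "\<dots> \<le> sqrt (real n) * \<bar>B (a i)\<bar>"
        using rate_le_sqrt[OF elim(4)] by (intro mult_right_mono) auto
      finally have 1: "- (rate n * B (a i)) \<le> sqrt (real n) * \<bar>B (a i)\<bar>" .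
      have 2: "C * (1 + ln (real n)) \<le> \<bar>C\<bar> * (1 + ln (real n))"
        using l0 by (intro mult_right_mono) auto
      have "C' * (1 + ln (real n) + sqrt (real n)) = 1 + ln (real n) + sqrt (real n) * (1 + \<bar>C\<bar>)
          + \<bar>C\<bar> * (1 + ln (real n)) + sqrt (real n) * \<bar>B (a i)\<bar> + \<bar>B (a i)\<bar> * (1 + ln (real n))"
        by (simp add: C'_def algebra_simps)
      moreover have "0 \<le> \<bar>B (a i)\<bar> * (1 + ln (real n))" "0 \<le> sqrt (real n) * (1 + \<bar>C\<bar>)"
        using l0 by auto
      moreover have "c * real n = c / 2 * real n + c / 2 * real n" by simp
      ultimately have "1 + ln (real n) + (real n * Amax - c * real n) - H n (grid_index a n i)
          \<le> - (c / 2 * real n)"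
        using 1 2 elim(2,3) by linarith
      then show ?thesis by simp
    qed
    finally show ?case .
  qed
  then show ?thesis using that[of "c / 2"] c by simp
qed

text \<open>Here the reference point has to come from J1, so that \<open>rate n * Bmax\<close>
  cancels; what remains is g \<open>rate n\<close> against O(log n).\<close>

lemma gibbs_prob_off_J1:
  assumes "0 < d" "d < \<delta>star"
  obtains c where "c > 0" "\<forall>\<^sub>F n in sequentially.
    gibbs_prob n (\<lambda>k. \<forall>j\<in>J1 B J a. \<bar>real k / real n - a j\<bar> > d) \<le> exp (- c * rate n)"
proof -
  obtain g where g: "g > 0" and off: "\<forall>\<^sub>F n in sequentially. \<forall>k\<le>n.
    (\<forall>j\<in>J1 B J a. \<bar>real k / real n - a j\<bar> > d) \<longrightarrow>
      H n k \<le> real n * Amax + rate n * (Bmax - g)"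
    by (rule H_upper_off_J1[OF assms]) (rule that)
  obtain i where i: "i \<in> J" "B (a i) = Bmax" using J1_nonempty J1_iff by blast
  obtain C where low: "\<forall>\<^sub>F n in sequentially.
    H n (grid_index a n i) \<ge> real n * Amax + rate n * B (a i) - C * (1 + ln (real n))"
    by (rule H_lower_grid_index[OF i(1)]) (rule that)
  have p: "1 / (2 * real mstar) > 0" using mstar by simp
  have "\<forall>\<^sub>F n in sequentially.
    gibbs_prob n (\<lambda>k. \<forall>j\<in>J1 B J a. \<bar>real k / real n - a j\<bar> > d) \<le> exp (- (g / 2) * rate n)"
    using off low eventually_log_powr_less[OF half_gt_zero[OF g] p, of "1 + C"]
      eventually_ge_at_top[of 1]
  proof eventually_elim
    case (elim n)
    have "gibbs_prob n (\<lambda>k. \<forall>j\<in>J1 B J a. \<bar>real k / real n - a j\<bar> > d)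
        \<le> exp (1 + ln (real n) + (real n * Amax + rate n * (Bmax - g)) - H n (grid_index a n i))"
      using elim(1) grid_index_close(1)[OF i(1) elim(4)] elim(4) by (intro gibbs_prob_le_exp) auto
    also have "\<dots> \<le> exp (- (g / 2) * rate n)"
    proof -
      have "rate n * (Bmax - g) = rate n * Bmax - g / 2 * rate n - g / 2 * rate n"
        by (simp add: algebra_simps)
      moreover have "(1 + C) * (1 + ln (real n)) = 1 + ln (real n) + C * (1 + ln (real n))"
        by (simp add: algebra_simps)
      ultimately show ?thesis using elim(2,3) i(2) by simp
    qed
    finally show ?case .
  qed
  then show ?thesis using that[of "g / 2"] g by simp
qed

section \<open>Comparison of the error terms\<close>

lemma J2_iff: "j \<in> J2 B J a m \<longleftrightarrow> j \<in> J1 B J a \<and> (\<forall>i\<in>J1 B J a. m i \<le> m j)"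
proof -
  have fin: "finite (m ` J1 B J a)"
    using finite_J by (simp add: J1_def)
  show ?thesis
  proof
    assume "j \<in> J2 B J a m"
    then show "j \<in> J1 B J a \<and> (\<forall>i\<in>J1 B J a. m i \<le> m j)"
      using fin by (auto simp: J2_def)
  next
    assume j: "j \<in> J1 B J a \<and> (\<forall>i\<in>J1 B J a. m i \<le> m j)"
    then have "Max (m ` J1 B J a) = m j"
      using fin by (intro Max_eqI) auto
    with j show "j \<in> J2 B J a m" by (simp add: J2_def)
  qed
qed

lemma max_power_ge_1:
  assumes "j \<in> J2 B J a m" "J1 B J a \<noteq> J2 B J a m" "n \<ge> 1"
  shows "1 \<le> max_power m (J1 B J a - J2 B J a m) (m j) n"
proof -
  let ?K = "J1 B J a - J2 B J a m"
  let ?f = "\<lambda>k. real n powr (1 / (2 * real (m k)) - 1 / (2 * real (m j)))"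
  have "J2 B J a m \<subseteq> J1 B J a" by (auto simp: J2_def)
  then obtain k where k: "k \<in> ?K" using assms(2) by blast
  have "k \<in> J" "m k \<le> m j"
    using k assms(1) by (auto simp: J1_iff J2_iff)
  then have "1 \<le> ?f k"
    using m_ge[of k] assms(3) by (intro ge_one_powr_ge_zero) (auto simp: field_simps)
  also have "\<dots> \<le> Max (?f ` ?K)"
    using k finite_J by (intro Max_ge) (auto simp: J1_def)
  finally show ?thesis using k by (auto simp: max_power_def)
qed

text \<open>\<open>tau_star\<close> is \<open>laplace_error\<close> with each term multiplied by a
  power of log n, hence at least as large once log n \<ge> 1.\<close>

lemma laplace_error_bigo_tau_star:
  assumes "j \<in> J"
  shows "laplace_error j \<in> O(\<lambda>n. tau_star mstar (m j) n)"
proof (rule bigoI[where c = 1])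
  have "\<forall>\<^sub>F n in sequentially. 1 \<le> ln (real n)" by real_asymp
  then show "\<forall>\<^sub>F n in sequentially. norm (laplace_error j n) \<le> 1 * norm (tau_star mstar (m j) n)"
    using eventually_ge_at_top[of 1]
  proof eventually_elim
    case (elim n)
    have "1 / rate n \<le> ln (real n) ^ (2 * mstar + 1) / rate n"
      using elim by (intro divide_right_mono one_le_power) auto
    moreover have "(if m j = mstar then 0 else rate n / width j n)
        \<le> real n powr (1 / (2 * real mstar) - 1 / (2 * real (m j))) * ln (real n)
            * of_bool (m j \<noteq> mstar)"
    proof (cases "m j = mstar")
      case False
      have "real n powr (1 / (2 * real mstar) - 1 / (2 * real (m j))) * 1
          \<le> real n powr (1 / (2 * real mstar) - 1 / (2 * real (m j))) * ln (real n)"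
        using elim by (intro mult_left_mono) auto
      then show ?thesis using False by (simp add: powr_diff width_def)
    qed simp
    ultimately have "laplace_error j n \<le> tau_star mstar (m j) n"
      unfolding laplace_error_def tau_star_def by (rule add_mono)
    then show ?case
      using laplace_error_bounds(1)[OF assms elim(2)] by simp
  qed
qed

lemma inverse_rate_bigo_laplace_error:
  assumes "j \<in> J"
  shows "(\<lambda>n. 1 / rate n) \<in> O(laplace_error j)"
proof (rule bigoI[where c = 1])
  show "\<forall>\<^sub>F n in sequentially. norm (1 / rate n) \<le> 1 * norm (laplace_error j n)"
    using eventually_ge_at_top[of 1]
  proof eventually_elim
    case (elim n)
    then show ?case
      using laplace_error_bounds(1,2)[OF assms elim] by simp
  qed
qed

text \<open>From exp(-t) \<le> 1 / t with t = c \<open>rate n\<close>.\<close>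

lemma exp_rate_bigo_laplace_error:
  assumes "j \<in> J" "c > 0"
  shows "(\<lambda>n. exp (- c * rate n)) \<in> O(laplace_error j)"
proof -
  have "(\<lambda>n. exp (- c * rate n)) \<in> O(\<lambda>n. 1 / rate n)"
  proof (rule bigoI[where c = "1 / c"])
    show "\<forall>\<^sub>F n in sequentially. norm (exp (- c * rate n)) \<le> 1 / c * norm (1 / rate n)"
      using eventually_ge_at_top[of 1]
    proof eventually_elim
      case (elim n)
      have r: "0 < c * rate n" using rate_ge_1[OF elim] assms(2) by (intro mult_pos_pos) linarith+
      have "c * rate n \<le> exp (c * rate n)"
        using exp_ge_add_one_self[of "c * rate n"] by linarith
      then have "inverse (exp (c * rate n)) \<le> inverse (c * rate n)"
        using r by (intro le_imp_inverse_le)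
      then show ?case by (simp add: exp_minus field_simps)
    qed
  qed
  then show ?thesis
    by (rule landau_o.big_trans[OF _ inverse_rate_bigo_laplace_error[OF assms(1)]])
qed

text \<open>By (A4) the exponents differ by at most \<open>Cstar / rate n\<close>. This is at most
  \<open>Cstar\<close>, which provides the common upper bound required by
  \<open>abs_exp_diff_le\<close>.\<close>

lemma A4_exp_base_bigo:
  assumes "cond_A4 An B J a m mstar Cstar \<nu>" and i: "i \<in> J2 B J a m" and j: "j \<in> J2 B J a m"
  shows "(\<lambda>n. exp (base i n - base j n) - exp (\<nu> i - \<nu> j)) \<in> O(laplace_error j)"
proof -
  have J: "j \<in> J" "B (a i) = Bmax" "B (a j) = Bmax"
    using i j by (auto simp: J2_iff J1_iff)
  define K where "K = Cstar * exp (\<nu> i - \<nu> j + Cstar)"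
  have "(\<lambda>n. exp (base i n - base j n) - exp (\<nu> i - \<nu> j)) \<in> O(\<lambda>n. 1 / rate n)"
  proof (rule bigoI[where c = K])
    have "\<forall>\<^sub>F n in sequentially.
        \<bar>real n * (An n (real (grid_index a n i) / real n) - An n (real (grid_index a n j) / real n))
          - (\<nu> i - \<nu> j)\<bar> \<le> Cstar / (real n * sigma_star mstar n)"
      using assms(1) unfolding cond_A4_def by (rule eventually_mono) (use i j in blast)
    then show "\<forall>\<^sub>F n in sequentially. norm (exp (base i n - base j n) - exp (\<nu> i - \<nu> j))
        \<le> K * norm (1 / rate n)"
      using eventually_ge_at_top[of 1]
    proof eventually_elim
      case (elim n)
      define u where "u = base i n - base j n"
      have r: "1 \<le> rate n" using rate_ge_1[OF elim(2)] .
      have u: "\<bar>u - (\<nu> i - \<nu> j)\<bar> \<le> Cstar / rate n"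
        using elim(1) sigma_star_eq[OF elim(2)] J by (simp add: u_def base_def algebra_simps)
      also have "Cstar / rate n \<le> Cstar / 1"
        using r Cstar by (intro divide_left_mono) linarith+
      finally have "u \<le> \<nu> i - \<nu> j + Cstar" "\<nu> i - \<nu> j \<le> \<nu> i - \<nu> j + Cstar"
        using Cstar by auto
      then have "\<bar>exp u - exp (\<nu> i - \<nu> j)\<bar> \<le> \<bar>u - (\<nu> i - \<nu> j)\<bar> * exp (\<nu> i - \<nu> j + Cstar)"
        by (rule abs_exp_diff_le)
      also have "\<dots> \<le> Cstar / rate n * exp (\<nu> i - \<nu> j + Cstar)"
        using u by (intro mult_right_mono) auto
      finally show ?case
        using r by (simp add: u_def K_def)
    qed
  qed
  then show ?thesis
    by (rule landau_o.big_trans[OF _ inverse_rate_bigo_laplace_error[OF J(1)]])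
qed

section \<open>Limiting weights of the wells\<close>

lemma gibbs_prob_near_eq:
  "gibbs_prob n (\<lambda>k. \<bar>real k / real n - a j\<bar> \<le> d) = well_sum d j n / Z_fun mstar An Bn n"
  by (simp add: gibbs_prob_def well_sum_def)

lemma gibbs_prob_near_union:
  assumes I: "I \<subseteq> J" and d: "0 < d" "d < \<delta>star"
  shows "gibbs_prob n (\<lambda>k. \<exists>j\<in>I. \<bar>real k / real n - a j\<bar> \<le> d)
      = (\<Sum>j\<in>I. well_sum d j n) / Z_fun mstar An Bn n"
proof -
  have "finite I" using I finite_J by (rule finite_subset)
  then show ?thesis
    using I
  proof (induction I rule: finite_induct)
    case empty
    then show ?case by (simp add: gibbs_prob_def)
  next
    case (insert i I)
    have "\<not> (\<bar>x - a i\<bar> \<le> d \<and> (\<exists>j\<in>I. \<bar>x - a j\<bar> \<le> d))" for x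
    proof
      assume x: "\<bar>x - a i\<bar> \<le> d \<and> (\<exists>j\<in>I. \<bar>x - a j\<bar> \<le> d)"
      then obtain j where j: "j \<in> I" "\<bar>x - a j\<bar> \<le> d" by blast
      then have "j \<in> J" "i \<in> J" "j \<noteq> i" using insert by auto
      moreover have "\<bar>x - a i\<bar> \<le> \<delta>star" using x d by linarith
      ultimately have "\<delta>star \<le> \<bar>x - a j\<bar>" by (rule separated)
      then show False using j d by linarith
    qed
    then have "gibbs_prob n (\<lambda>k. \<bar>real k / real n - a i\<bar> \<le> d \<or> (\<exists>j\<in>I. \<bar>real k / real n - a j\<bar> \<le> d))
        = gibbs_prob n (\<lambda>k. \<bar>real k / real n - a i\<bar> \<le> d)
          + gibbs_prob n (\<lambda>k. \<exists>j\<in>I. \<bar>real k / real n - a j\<bar> \<le> d)"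
      by (intro gibbs_prob_disjoint)
    with insert show ?case
      by (simp add: gibbs_prob_near_eq add_divide_distrib)
  qed
qed

text \<open>All wells of J2 have the same \<open>width\<close>, so the normalisation of well j can
  be used for each of them and cancels in \<open>W j n / D n\<close>, whose limit is p_j. As J1 =
  J2, the mass r outside these wells is exponentially small in \<open>rate n\<close>, and r also
  bounds the distance between this ratio and the probability.\<close>

lemma gibbs_prob_near_asymptotics:
  assumes A4: "cond_A4 An B J a m mstar Cstar \<nu>"
    and J12: "J1 B J a = J2 B J a m" and j: "j \<in> J2 B J a m"
  shows "(\<lambda>n. gibbs_prob n (\<lambda>k. \<bar>real k / real n - a j\<bar> \<le> \<delta>star) - p_weight A B J a m mstar \<nu> j)
    \<in> O(laplace_error j)"
proof -
  define d where "d = \<delta>star / 2"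
  have d: "0 < d" "d < \<delta>star" using del by (auto simp: d_def)
  define I where "I = J2 B J a m"
  have I: "I \<subseteq> J" "finite I" "j \<in> I"
    using finite_J j by (auto simp: I_def J2_def J1_def)
  then have jJ: "j \<in> J" by blast
  have same: "laplace_error i = laplace_error j" "width i = width j" if "i \<in> I" for i
    using that j unfolding I_def by (auto simp: J2_def laplace_error_def width_def fun_eq_iff)
  define q where "q i = q_weight A B a m mstar i" for i
  \<comment> \<open>\<open>W i\<close> is normalised by its own base and tends to q_i; the factor
    \<open>exp (base i n - base j n)\<close> in \<open>D\<close> restores the common normalisation
    and has a limit by (A4).\<close>
  define W where "W i n = width j n / real n * exp (- base i n) * well_sum d i n" for i n
  define D where "D n = (\<Sum>i\<in>I. W i n * exp (base i n - base j n))" for n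
  define D' where "D' = (\<Sum>i\<in>I. q i * exp (\<nu> i - \<nu> j))"
  have W: "(\<lambda>n. W i n - q i) \<in> O(laplace_error j)" if "i \<in> I" for i
    using well_sum_asymptotics[OF _ d, of i] that I(1) same[OF that]
    by (auto simp: W_def q_def)
  have e0: "laplace_error j \<in> O(\<lambda>_. 1)"
    using laplace_error_tendsto_0[OF jJ] by (intro bigoI_tendsto[where c = 0]) auto
  have summand: "(\<lambda>n. W i n * exp (base i n - base j n) - q i * exp (\<nu> i - \<nu> j)) \<in> O(laplace_error j)"
    if "i \<in> I" for i
  proof -
    let ?E = "\<lambda>n. exp (base i n - base j n)" and ?e = "exp (\<nu> i - \<nu> j)"
    have E: "(\<lambda>n. ?E n - ?e) \<in> O(laplace_error j)"
      using A4_exp_base_bigo[OF A4 _ j] that by (simp add: I_def)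
    have "(\<lambda>n. (?E n - ?e) + ?e) \<in> O(\<lambda>_. 1)"
      by (intro sum_in_bigo(1) landau_o.big_trans[OF E e0]) simp
    then have "?E \<in> O(\<lambda>_. 1)" by simp
    from landau_o.big.mult[OF W[OF that] this]
    have "(\<lambda>n. (W i n - q i) * ?E n) \<in> O(laplace_error j)" by simp
    moreover have "(\<lambda>n. q i * (?E n - ?e)) \<in> O(laplace_error j)"
      using E by (cases "q i = 0") simp_all
    ultimately have "(\<lambda>n. (W i n - q i) * ?E n + q i * (?E n - ?e)) \<in> O(laplace_error j)"
      by (rule sum_in_bigo(1))
    then show ?thesis by (simp add: algebra_simps)
  qed
  have D: "(\<lambda>n. D n - D') \<in> O(laplace_error j)"
    unfolding D_def D'_def sum_subtractf[symmetric] using summand by (rule big_sum_in_bigo)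
  have "D' > 0"
    unfolding D'_def q_def using I q_weight_pos by (intro sum_pos) auto
  then have ratio: "(\<lambda>n. W j n / D n - q j / D') \<in> O(laplace_error j)"
    using W[OF I(3)] D laplace_error_tendsto_0[OF jJ] by (intro bigo_quotient) auto
  have p: "q j / D' = p_weight A B J a m mstar \<nu> j"
  proof -
    have "D' = (\<Sum>i\<in>I. q i * exp (\<nu> i)) / exp (\<nu> j)"
      by (simp add: D'_def exp_diff sum_divide_distrib)
    then show ?thesis by (simp add: p_weight_def q_def I_def)
  qed
  obtain c where c: "c > 0" and off: "\<forall>\<^sub>F n in sequentially.
    gibbs_prob n (\<lambda>k. \<forall>j\<in>J1 B J a. \<bar>real k / real n - a j\<bar> > d) \<le> exp (- c * rate n)"
    by (rule gibbs_prob_off_J1[OF d]) (rule that)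
  have "(\<lambda>n. gibbs_prob n (\<lambda>k. \<bar>real k / real n - a j\<bar> \<le> \<delta>star) - W j n / D n)
      \<in> O(\<lambda>n. exp (- c * rate n))"
  proof (rule bigoI[where c = 1])
    show "\<forall>\<^sub>F n in sequentially.
      norm (gibbs_prob n (\<lambda>k. \<bar>real k / real n - a j\<bar> \<le> \<delta>star) - W j n / D n)
        \<le> 1 * norm (exp (- c * rate n))"
      using off eventually_ge_at_top[of 1]
    proof eventually_elim
      case (elim n)
      define Z where "Z = Z_fun mstar An Bn n"
      define S where "S = (\<Sum>i\<in>I. well_sum d i n)"
      define s where "s = well_sum d j n"
      define r where "r = gibbs_prob n (\<lambda>k. \<forall>j\<in>J1 B J a. \<bar>real k / real n - a j\<bar> > d)"
      have "Z > 0" unfolding Z_def by (rule Z_fun_pos)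
      have w0: "width j n / real n \<noteq> 0"
        using width_bounds(1)[OF jJ elim(2)] elim(2) by auto
      have "D n = width j n / real n * exp (- base j n) * S"
      proof -
        have "W i n * exp (base i n - base j n)
            = width j n / real n * exp (- base j n) * well_sum d i n" for i
        proof -
          have "exp (- base i n) * exp (base i n - base j n) = exp (- base j n)"
            by (simp add: exp_add[symmetric])
          then show ?thesis by (simp add: W_def mult_ac)
        qed
        then show ?thesis by (simp add: D_def S_def sum_distrib_left)
      qed
      then have quot: "W j n / D n = s / S"
        using w0 by (simp add: W_def s_def)
      have s: "0 \<le> s" "s \<le> S"
        unfolding s_def S_def well_sum_def using I
        by (auto intro!: sum_nonneg member_le_sum[of j I "\<lambda>i. \<Sum>k | k \<le> n \<and> \<bar>real k / real n - a i\<bar> \<le> d. exp (H n k)"])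
      then have t: "0 \<le> s / S" "s / S \<le> 1"
        by (auto simp: divide_le_eq)
      have rest: "S / Z = 1 - r"
      proof -
        have "gibbs_prob n (\<lambda>k. (\<exists>i\<in>I. \<bar>real k / real n - a i\<bar> \<le> d) \<or>
            (\<forall>i\<in>J1 B J a. \<bar>real k / real n - a i\<bar> > d)) = S / Z + r"
          unfolding r_def S_def Z_def gibbs_prob_near_union[OF I(1) d, symmetric]
          by (intro gibbs_prob_disjoint) (auto simp: I_def J12[symmetric] not_le)
        moreover have "(\<lambda>k. (\<exists>i\<in>I. \<bar>real k / real n - a i\<bar> \<le> d) \<or>
            (\<forall>i\<in>J1 B J a. \<bar>real k / real n - a i\<bar> > d)) = (\<lambda>k. True)"
          by (auto simp: I_def J12[symmetric] not_le fun_eq_iff)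
        ultimately show ?thesis using gibbs_prob_True[of n] by simp
      qed
      have r: "0 \<le> r" unfolding r_def by (rule gibbs_prob_nonneg)
      \<comment> \<open>If S = 0 then s = 0 and both sides vanish; otherwise s / Z = (s / S) (S /
        Z).\<close>
      have sZ: "s / Z = s / S * (1 - r)"
        using s \<open>Z > 0\<close> rest[symmetric] by (cases "S = 0") auto
      let ?P = "gibbs_prob n (\<lambda>k. \<bar>real k / real n - a j\<bar> \<le> \<delta>star)"
      have low: "s / Z \<le> ?P"
        unfolding s_def Z_def gibbs_prob_near_eq[symmetric] using d by (intro gibbs_prob_mono) auto
      have up: "?P \<le> s / Z + r"
      proof -
        \<comment> \<open>Points of the ring d < |x - a_j| \<le> \<open>\<delta>star\<close> are far
          from a_j by choice, and from every other a_i by separation of the wells.\<close>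
        have *: "\<forall>i\<in>J1 B J a. \<bar>x - a i\<bar> > d" if "d < \<bar>x - a j\<bar>" "\<bar>x - a j\<bar> \<le> \<delta>star" for x
        proof
          fix i assume "i \<in> J1 B J a"
          then have "i \<in> J" by (simp add: J1_iff)
          then show "\<bar>x - a i\<bar> > d"
            using separated[of i j x] jJ that d by (cases "i = j") auto
        qed
        have "?P \<le> gibbs_prob n (\<lambda>k. \<bar>real k / real n - a j\<bar> \<le> d \<or>
            (\<forall>i\<in>J1 B J a. \<bar>real k / real n - a i\<bar> > d))"
          using * by (intro gibbs_prob_mono) (metis not_le)
        also have "\<dots> = s / Z + r"
          unfolding s_def Z_def r_def gibbs_prob_near_eq[symmetric]
          using j J12 by (intro gibbs_prob_disjoint) force
        finally show ?thesis .
      qed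
      \<comment> \<open>The probability lies between (s / S) (1 - r) and that value plus r; as s / S
        is in [0, 1], it is within r of s / S.\<close>
      have "s / S * r \<le> 1 * r" "0 \<le> s / S * r"
        by (rule mult_right_mono[OF t(2) r], rule mult_nonneg_nonneg[OF t(1) r])
      then have "\<bar>?P - s / S\<bar> \<le> r"
        using low up unfolding sZ right_diff_distrib by linarith
      then show ?case
        using elim(1) by (simp add: quot r_def)
    qed
  qed
  then have "(\<lambda>n. gibbs_prob n (\<lambda>k. \<bar>real k / real n - a j\<bar> \<le> \<delta>star) - W j n / D n)
      \<in> O(laplace_error j)"
    by (rule landau_o.big_trans[OF _ exp_rate_bigo_laplace_error[OF jJ c]])
  from sum_in_bigo(1)[OF this ratio] show ?thesis
    unfolding p by simp
qed

end

section \<open>Transfer of the estimates to the random variables X_n\<close>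

theorem theorem2p3:
  fixes mstar :: nat
    and An Bn :: "nat \<Rightarrow> real \<Rightarrow> real"
    and A B :: "real \<Rightarrow> real"
    and M :: "nat \<Rightarrow> 'w measure"
    and X :: "nat \<Rightarrow> 'w \<Rightarrow> nat"
    and J :: "'j set"
    and a :: "'j \<Rightarrow> real"
    and m :: "'j \<Rightarrow> nat"
    and \<epsilon>star \<delta>star Cstar \<delta> :: real
  assumes "mstar \<ge> 1"
    and "\<epsilon>star > 0" "\<delta>star > 0" "Cstar > 0"
    and "finite J" "\<forall>j\<in>J. a j \<in> {0<..<1}" "\<forall>j\<in>J. m j \<ge> 1"
    and "C_k_on (2 * mstar + 1) A {0..1}" "C_k_on 2 B {0..1}"
    and "\<forall>n\<ge>1. prob_space (M n)"
    and "\<forall>n\<ge>1. X n \<in> measurable (M n) (count_space UNIV)"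
    and "\<forall>n\<ge>1. \<forall>k\<le>n. \<P>(\<omega> in M n. X n \<omega> = k) =
           exp (H_fun mstar An Bn n k) / Z_fun mstar An Bn n"
    and "cond_A1 A J a m mstar \<delta>star"
    and "cond_A2 An Bn A J a \<epsilon>star \<delta>star Cstar"
    and "cond_A3 An Bn A B J a \<delta>star Cstar"
    and "0 < \<delta>" "\<delta> < \<delta>star"
  shows "(\<exists>c>0. \<forall>\<^sub>F n in sequentially.
             \<P>(\<omega> in M n. \<forall>j\<in>J. \<bar>real (X n \<omega>) / real n - a j\<bar> > \<delta>)
               \<le> exp (- c * real n) \<and>
             \<P>(\<omega> in M n. \<forall>j\<in>J1 B J a. \<bar>real (X n \<omega>) / real n - a j\<bar> > \<delta>)
               \<le> exp (- c * real n * sigma_star mstar n)) \<and>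
         (\<forall>j2\<in>J2 B J a m.
             (\<exists>C. J1 B J a \<noteq> J2 B J a m \<longrightarrow>
               (\<forall>n\<ge>1. \<P>(\<omega> in M n. \<forall>j\<in>J2 B J a m. \<bar>real (X n \<omega>) / real n - a j\<bar> > \<delta>)
                  \<le> C * max_power m (J1 B J a - J2 B J a m) (m j2) n)) \<and>
             (\<forall>\<nu>. cond_A4 An B J a m mstar Cstar \<nu> \<longrightarrow>
               (\<forall>j\<in>J2 B J a m.
                  \<exists>R1 \<in> O(\<lambda>n. tau_star mstar (m j2) n).
                  \<exists>R2 \<in> O(\<lambda>n. max_power m (J1 B J a - J2 B J a m) (m j) n).
                  \<forall>n\<ge>1. \<P>(\<omega> in M n. \<bar>real (X n \<omega>) / real n - a j\<bar> \<le> \<delta>star)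
                    = p_weight A B J a m mstar \<nu> j + R1 n + R2 n)))"
proof -
  interpret gibbs_maximizers mstar An Bn A B J a m \<epsilon>star \<delta>star Cstar
    using assms by unfold_locales auto
  have prob: "\<P>(\<omega> in M n. Q (X n \<omega>)) = gibbs_prob n Q" if "n \<ge> 1" for n Q
  proof -
    have "(\<Sum>k\<le>n. exp (H n k) / Z_fun mstar An Bn n) = 1"
      using gibbs_prob_True[of n] by (simp add: gibbs_prob_def sum_divide_distrib atMost_def)
    then have "\<P>(\<omega> in M n. Q (X n \<omega>)) = (\<Sum>k | k \<le> n \<and> Q k. exp (H n k) / Z_fun mstar An Bn n)"
      using assms(10-12) that by (intro prob_eq_sum_weights) auto
    then show ?thesis
      by (simp add: gibbs_prob_def sum_divide_distrib)
  qed
  let ?mp = "\<lambda>j n. max_power m (J1 B J a - J2 B J a m) (m j) n"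
  obtain c1 where c1: "c1 > 0" and far: "\<forall>\<^sub>F n in sequentially.
    gibbs_prob n (\<lambda>k. \<forall>j\<in>J. \<bar>real k / real n - a j\<bar> > \<delta>) \<le> exp (- c1 * real n)"
    by (rule gibbs_prob_far[OF \<open>0 < \<delta>\<close>]) (rule that)
  obtain c2 where c2: "c2 > 0" and off: "\<forall>\<^sub>F n in sequentially.
    gibbs_prob n (\<lambda>k. \<forall>j\<in>J1 B J a. \<bar>real k / real n - a j\<bar> > \<delta>) \<le> exp (- c2 * rate n)"
    by (rule gibbs_prob_off_J1[OF \<open>0 < \<delta>\<close> \<open>\<delta> < \<delta>star\<close>]) (rule that)
  \<comment> \<open>The statement asks for one constant in both bounds.\<close>
  define c where "c = min c1 c2"
  have c: "c > 0" "c \<le> c1" "c \<le> c2" using c1 c2 by (auto simp: c_def)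
  have part1: "\<forall>\<^sub>F n in sequentially.
      \<P>(\<omega> in M n. \<forall>j\<in>J. \<bar>real (X n \<omega>) / real n - a j\<bar> > \<delta>) \<le> exp (- c * real n) \<and>
      \<P>(\<omega> in M n. \<forall>j\<in>J1 B J a. \<bar>real (X n \<omega>) / real n - a j\<bar> > \<delta>)
        \<le> exp (- c * real n * sigma_star mstar n)"
    using far off eventually_ge_at_top[of 1]
  proof eventually_elim
    case (elim n)
    have "c * real n \<le> c1 * real n" "c * rate n \<le> c2 * rate n"
      using c by (auto intro!: mult_right_mono)
    then have "exp (- c1 * real n) \<le> exp (- c * real n)" "exp (- c2 * rate n) \<le> exp (- c * rate n)"
      by auto
    moreover have "exp (- c * real n * sigma_star mstar n) = exp (- c * rate n)"
      using sigma_star_eq[OF elim(3)] by (simp add: mult.assoc)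
    ultimately show ?case
      unfolding prob[OF elim(3), of "\<lambda>k. \<forall>j\<in>J. \<bar>real k / real n - a j\<bar> > \<delta>"]
        prob[OF elim(3), of "\<lambda>k. \<forall>j\<in>J1 B J a. \<bar>real k / real n - a j\<bar> > \<delta>"]
      using elim(1,2) by (intro conjI; linarith)
  qed
  have part2: "\<exists>C. J1 B J a \<noteq> J2 B J a m \<longrightarrow>
      (\<forall>n\<ge>1. \<P>(\<omega> in M n. \<forall>j\<in>J2 B J a m. \<bar>real (X n \<omega>) / real n - a j\<bar> > \<delta>) \<le> C * ?mp j2 n)"
    if "j2 \<in> J2 B J a m" for j2
  proof (intro exI[of _ 1] impI allI)
    fix n :: nat
    assume J12: "J1 B J a \<noteq> J2 B J a m" and n: "n \<ge> 1"
    show "\<P>(\<omega> in M n. \<forall>j\<in>J2 B J a m. \<bar>real (X n \<omega>) / real n - a j\<bar> > \<delta>) \<le> 1 * ?mp j2 n"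
      unfolding prob[OF n, of "\<lambda>k. \<forall>j\<in>J2 B J a m. \<bar>real k / real n - a j\<bar> > \<delta>"]
      using max_power_ge_1[OF that J12 n] by (intro order_trans[OF gibbs_prob_le_1]) simp
  qed
  have part3: "\<exists>R1 \<in> O(\<lambda>n. tau_star mstar (m j2) n). \<exists>R2 \<in> O(\<lambda>n. ?mp j n).
      \<forall>n\<ge>1. \<P>(\<omega> in M n. \<bar>real (X n \<omega>) / real n - a j\<bar> \<le> \<delta>star)
        = p_weight A B J a m mstar \<nu> j + R1 n + R2 n"
    if j2: "j2 \<in> J2 B J a m" and A4: "cond_A4 An B J a m mstar Cstar \<nu>" and j: "j \<in> J2 B J a m"
    for j2 j \<nu>
  proof -
    let ?p = "p_weight A B J a m mstar \<nu> j"
    define R where "R n = gibbs_prob n (\<lambda>k. \<bar>real k / real n - a j\<bar> \<le> \<delta>star) - ?p" for n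
    have eq: "\<P>(\<omega> in M n. \<bar>real (X n \<omega>) / real n - a j\<bar> \<le> \<delta>star) = ?p + R n" if "n \<ge> 1" for n
      using prob[OF that, of "\<lambda>k. \<bar>real k / real n - a j\<bar> \<le> \<delta>star"] by (simp add: R_def)
    \<comment> \<open>If J1 = J2, \<open>max_power\<close> is 0 by convention, so R2 has to vanish
      and R1 takes the whole error. Otherwise R2 takes all of it and R1 = 0.\<close>
    show ?thesis
    proof (cases "J1 B J a = J2 B J a m")
      case True
      have "m j2 = m j" using j j2 by (simp add: J2_def)
      moreover have "j \<in> J" using j by (simp add: J2_def J1_def)
      ultimately have "R \<in> O(\<lambda>n. tau_star mstar (m j2) n)"
        using landau_o.big_trans[OF gibbs_prob_near_asymptotics[OF A4 True j]
            laplace_error_bigo_tau_star]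
        by (simp add: R_def[abs_def])
      then show ?thesis
        using eq by (intro bexI[of _ R] bexI[of _ "\<lambda>_. 0"]) auto
    next
      case False
      have "R \<in> O(\<lambda>n. ?mp j n)"
      proof (rule bigoI[where c = "1 + \<bar>?p\<bar>"])
        show "\<forall>\<^sub>F n in sequentially. norm (R n) \<le> (1 + \<bar>?p\<bar>) * norm (?mp j n)"
          using eventually_ge_at_top[of 1]
        proof eventually_elim
          case (elim n)
          have "norm (R n) \<le> (1 + \<bar>?p\<bar>) * 1"
            unfolding R_def
            using gibbs_prob_le_1[of n "\<lambda>k. \<bar>real k / real n - a j\<bar> \<le> \<delta>star"]
              gibbs_prob_nonneg[of n "\<lambda>k. \<bar>real k / real n - a j\<bar> \<le> \<delta>star"] by simp
          also have "\<dots> \<le> (1 + \<bar>?p\<bar>) * norm (?mp j n)"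
            using max_power_ge_1[OF j False elim] by (intro mult_left_mono) auto
          finally show ?case .
        qed
      qed
      then show ?thesis
        using eq by (intro bexI[of _ "\<lambda>_. 0"] bexI[of _ R]) auto
    qed
  qed
  show ?thesis
  proof (intro conjI ballI allI impI)
    show "\<exists>c>0. \<forall>\<^sub>F n in sequentially.
      \<P>(\<omega> in M n. \<forall>j\<in>J. \<bar>real (X n \<omega>) / real n - a j\<bar> > \<delta>) \<le> exp (- c * real n) \<and>
      \<P>(\<omega> in M n. \<forall>j\<in>J1 B J a. \<bar>real (X n \<omega>) / real n - a j\<bar> > \<delta>)
        \<le> exp (- c * real n * sigma_star mstar n)"
      using c(1) part1 by (intro exI[of _ c] conjI)
  qed (rule part2 part3; assumption)+
qed

end
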